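(* Let $(A,\varrho_A,[\cdot,\cdot])$ be a skew-symmetric algebroid over a manifold $M$ equipped with a pseudo-Riemannian metric $g\in\Gamma(\mathsf{S}^2A^* )$ in $A$. The Levi-Civita connection with respect to $g$ is given by $$\nabla_XY=\tfrac12\big([X,Y]+\langle X:Y\rangle^s\big),$$ where $$\langle X:Y\rangle^s=\sharp\big(\mathcal{L}^a_XY^\flat+\mathcal{L}^a_YX^\flat-d^a(g(X,Y))\big)$$ for $X,Y\in\Gamma(A)$.
   Context: A skew-symmetric algebroid $(A,\varrho_A,[\cdot,\cdot])$ over $M$ is a vector bundle $A\to M$ with a vector bundle homomorphism $\varrho_A:A\to TM$ over the identity (anchor) and an $\mathbb{R}$-bilinear skew-symmetric map $[\cdot,\cdot]:\Gamma(A)\times\Gamma(A)\to\Gamma(A)$ with $[X,fY]=f[X,Y]+(\varrho_A\circ X)(f)\,Y$ for $X,Y\in\Gamma(A)$, $f\in C^\infty(M)$ (no Jacobi identity is assumed, and the anchor need not preserve brackets). An $A$-connection in $A$ is an $\mathbb{R}$-bilinear map $\nabla:\Gamma(A)\times\Gamma(A)\to\Gamma(A)$ with $\nabla_{fX}Y=f\nabla_XY$ and $\nabla_X(fY)=f\nabla_XY+(\varrho_A\circ X)(f)Y$. Its torsion is $T^\nabla(X,Y)=\nabla_XY-\nabla_YX-[X,Y]$, and $(\nabla g)(X,Y,Z)=(\varrho_A\circ X)(g(Y,Z))-g(\nabla_XY,Z)-g(Y,\nabla_XZ)$. The Levi-Civita connection with respect to $g$ is the unique $A$-connection in $A$ with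 $T^\nabla=0$ and $\nabla g=0$. A pseudo-Riemannian metric $g$ in $A$ is a nondegenerate section of $\mathsf{S}^2A^*$; $X^\flat=g(X,\cdot)$ and $\sharp:A^*\to A$ is given by $g(\sharp(\omega),X)=\omega(X)$. For $f\in C^\infty(M)$, $(d^af)(X)=(\varrho_A\circ X)(f)$. The (alternating) Lie derivative of $\omega\in\Gamma(A^* )$ is $(\mathcal{L}^a_X\omega)(Y)=(\varrho_A\circ X)(\omega(Y))-\omega([X,Y])$. *)

theory Defs
  imports "HOL-Analysis.Analysis" "HOL-Library.Function_Algebras"
begin

text \<open>Functions, sections and forms are added and scaled pointwise.\<close>

instantiation "fun" :: (type, real_vector) real_vector
begin

definition scaleR_fun :: "real \<Rightarrow> ('a \<Rightarrow> 'b) \<Rightarrow> 'a \<Rightarrow> 'b"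
  where "scaleR_fun c f = (\<lambda>x. c *\<^sub>R f x)"

instance
  by standard (simp_all add: scaleR_fun_def fun_eq_iff algebra_simps)

end

lemma scaleR_fun_apply [simp]: "(c *\<^sub>R f) x = c *\<^sub>R f x"
  for f :: "'a \<Rightarrow> 'b::real_vector"
  by (simp add: scaleR_fun_def)


text \<open>
  Model spaces have the sort \<open>{real_inner, heine_borel}\<close>: these are the finite-dimensional real
  inner product spaces. Unlike \<open>euclidean_space\<close> the sort admits the zero space, so manifolds of
  dimension 0 and bundles of rank 0 are included. The inner product only serves to provide the
  standard topology of the model space. The set \<open>S\<close> is always open below.
\<close>

primrec C_diff_on :: "nat \<Rightarrow> 'e set \<Rightarrow> ('e::real_normed_vector \<Rightarrow> 'b::real_normed_vector) \<Rightarrow> bool"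
  where
    "C_diff_on 0 S f \<longleftrightarrow> continuous_on S f"
  | "C_diff_on (Suc k) S f \<longleftrightarrow>
      (\<forall>x\<in>S. f differentiable (at x)) \<and>
      (\<forall>v. C_diff_on k S (\<lambda>x. frechet_derivative f (at x) v))"

definition smooth_on :: "'e set \<Rightarrow> ('e::real_normed_vector \<Rightarrow> 'b::real_normed_vector) \<Rightarrow> bool"
  where "smooth_on S f \<longleftrightarrow> (\<forall>k. C_diff_on k S f)"


section \<open>Smooth manifolds\<close>

text \<open>
  The underlying space of the manifold is the whole type \<open>'m\<close>; a chart is a pair of an open set
  and a coordinate map, which is only relevant on that set. Atlases need not be maximal.
\<close>

type_synonym ('m, 'e) atlas = "('m set \<times> ('m \<Rightarrow> 'e)) set"

definition smooth_manifold ::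
  "('m::{t2_space, second_countable_topology}, 'e::{real_inner, heine_borel}) atlas \<Rightarrow> bool"
  where "smooth_manifold M \<longleftrightarrow>
    (\<forall>(U, \<phi>)\<in>M. open U \<and> open (\<phi> ` U) \<and> homeomorphism U (\<phi> ` U) \<phi> (inv_into U \<phi>)) \<and>
    (\<Union>(U, \<phi>)\<in>M. U) = UNIV \<and>
    (\<forall>(U, \<phi>)\<in>M. \<forall>(V, \<psi>)\<in>M. smooth_on (\<phi> ` (U \<inter> V)) (\<psi> \<circ> inv_into U \<phi>))"

definition smooth_fun_on ::
  "('m, 'e::real_normed_vector) atlas \<Rightarrow> 'm set \<Rightarrow> ('m \<Rightarrow> 'b::real_normed_vector) \<Rightarrow> bool"
  where "smooth_fun_on M W h \<longleftrightarrow>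
    (\<forall>(U, \<phi>)\<in>M. smooth_on (\<phi> ` (U \<inter> W)) (h \<circ> inv_into U \<phi>))"

definition C_infinity :: "('m, 'e::real_normed_vector) atlas \<Rightarrow> ('m \<Rightarrow> real) set"
  where "C_infinity M = {f. smooth_fun_on M UNIV f}"


section \<open>Vector bundles\<close>

text \<open>
  The fibres are linear subspaces of a common real vector space \<open>'v\<close> without topology, which is no
  restriction: every family of vector spaces embeds fibrewise into its direct sum. A local
  trivialisation over \<open>U\<close> is given by its inverse \<open>\<sigma>\<close>, where \<open>\<sigma> x\<close> is a linear isomorphism from
  the typical fibre \<open>'f\<close> onto the fibre over \<open>x\<close>. The smooth structure of the total space is
  determined by the trivialisations. As \<open>'f\<close> is finite-dimensional, a family of linear maps is
  smooth iff its value at each fixed vector of \<open>'f\<close> is.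
\<close>

record ('m, 'v, 'f) vbundle =
  fibre :: "'m \<Rightarrow> 'v set"
  trivs :: "('m set \<times> ('m \<Rightarrow> 'f \<Rightarrow> 'v)) set"

definition vector_bundle ::
  "('m::topological_space, 'e::real_normed_vector) atlas \<Rightarrow>
   ('m, 'v::real_vector, 'f::{real_inner, heine_borel}, 'z) vbundle_scheme \<Rightarrow> bool"
  where "vector_bundle M E \<longleftrightarrow>
    (\<forall>x. subspace (fibre E x)) \<and>
    (\<forall>(U, \<sigma>)\<in>trivs E. open U \<and> (\<forall>x\<in>U. linear (\<sigma> x) \<and> bij_betw (\<sigma> x) UNIV (fibre E x))) \<and>
    (\<Union>(U, \<sigma>)\<in>trivs E. U) = UNIV \<and>
    (\<forall>(U, \<sigma>)\<in>trivs E. \<forall>(V, \<tau>)\<in>trivs E. \<forall>w.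
      smooth_fun_on M (U \<inter> V) (\<lambda>x. inv (\<tau> x) (\<sigma> x w)))"

definition sections ::
  "('m, 'e::real_normed_vector) atlas \<Rightarrow>
   ('m, 'v, 'f::real_normed_vector, 'z) vbundle_scheme \<Rightarrow> ('m \<Rightarrow> 'v) set"
  where "sections M E = {X. (\<forall>x. X x \<in> fibre E x) \<and>
    (\<forall>(U, \<sigma>)\<in>trivs E. smooth_fun_on M U (\<lambda>x. inv (\<sigma> x) (X x)))}"

definition linear_on_set :: "'v::real_vector set \<Rightarrow> ('v \<Rightarrow> 'w::real_vector) \<Rightarrow> bool"
  where "linear_on_set S h \<longleftrightarrow>
    (\<forall>a\<in>S. \<forall>b\<in>S. h (a + b) = h a + h b) \<and> (\<forall>c. \<forall>a\<in>S. h (c *\<^sub>R a) = c *\<^sub>R h a)"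

definition bilinear_on_set :: "'v::real_vector set \<Rightarrow> ('v \<Rightarrow> 'v \<Rightarrow> 'w::real_vector) \<Rightarrow> bool"
  where "bilinear_on_set S B \<longleftrightarrow>
    (\<forall>a\<in>S. linear_on_set S (B a)) \<and> (\<forall>b\<in>S. linear_on_set S (\<lambda>a. B a b))"

definition bundle_hom ::
  "('m, 'e::real_normed_vector) atlas \<Rightarrow>
   ('m, 'v::real_vector, 'f, 'y) vbundle_scheme \<Rightarrow>
   ('m, 'w::real_vector, 'h::real_normed_vector, 'z) vbundle_scheme \<Rightarrow>
   ('m \<Rightarrow> 'v \<Rightarrow> 'w) \<Rightarrow> bool"
  where "bundle_hom M E F h \<longleftrightarrow>
    (\<forall>x. h x ` fibre E x \<subseteq> fibre F x \<and> linear_on_set (fibre E x) (h x)) \<and>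
    (\<forall>(U, \<sigma>)\<in>trivs E. \<forall>(V, \<tau>)\<in>trivs F. \<forall>w.
      smooth_fun_on M (U \<inter> V) (\<lambda>x. inv (\<tau> x) (h x (\<sigma> x w))))"


section \<open>The tangent bundle\<close>

text \<open>
  Tangent vectors at \<open>x\<close> are the operators \<open>\<Sum>\<^sub>i w\<^sub>i \<partial>/\<partial>\<phi>\<^sub>i\<close> at \<open>x\<close>, with \<open>w\<close> in the model
  space, acting on smooth functions. Outside the smooth functions they are set to 0, since otherwise
  the operators obtained from different charts could not be identified.
\<close>

definition coord_vector ::
  "('m, 'e::real_normed_vector) atlas \<Rightarrow> 'm set \<Rightarrow> ('m \<Rightarrow> 'e) \<Rightarrow> 'm \<Rightarrow> 'e \<Rightarrow> ('m \<Rightarrow> real) \<Rightarrow> real"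
  where "coord_vector M U \<phi> x w = (\<lambda>f.
    if f \<in> C_infinity M then frechet_derivative (f \<circ> inv_into U \<phi>) (at (\<phi> x)) w else 0)"

definition tangent_bundle ::
  "('m, 'e::real_normed_vector) atlas \<Rightarrow> ('m, ('m \<Rightarrow> real) \<Rightarrow> real, 'e) vbundle"
  where "tangent_bundle M =
    \<lparr>fibre = (\<lambda>x. {coord_vector M U \<phi> x w |U \<phi> w. (U, \<phi>) \<in> M \<and> x \<in> U}),
     trivs = {(U, coord_vector M U \<phi>) |U \<phi>. (U, \<phi>) \<in> M}\<rparr>"


section \<open>Skew-symmetric algebroids\<close>

definition fun_mult :: "('m \<Rightarrow> real) \<Rightarrow> ('m \<Rightarrow> 'v::real_vector) \<Rightarrow> 'm \<Rightarrow> 'v"  (infixr \<open>\<odot>\<close> 75)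
  where "f \<odot> X = (\<lambda>x. f x *\<^sub>R X x)"

record ('m, 'v, 'f) algebroid = "('m, 'v, 'f) vbundle" +
  anchor :: "'m \<Rightarrow> 'v \<Rightarrow> ('m \<Rightarrow> real) \<Rightarrow> real"
  bracket :: "('m \<Rightarrow> 'v) \<Rightarrow> ('m \<Rightarrow> 'v) \<Rightarrow> 'm \<Rightarrow> 'v"

text \<open>The function \<open>(\<rho> \<circ> X)(f)\<close>.\<close>

definition anchor_deriv ::
  "('m, 'v, 'f) algebroid \<Rightarrow> ('m \<Rightarrow> 'v) \<Rightarrow> ('m \<Rightarrow> real) \<Rightarrow> 'm \<Rightarrow> real"
  where "anchor_deriv A X f = (\<lambda>x. anchor A x (X x) f)"

definition skew_algebroid ::
  "('m::topological_space, 'e::real_normed_vector) atlas \<Rightarrow>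
   ('m, 'v::real_vector, 'f::{real_inner, heine_borel}) algebroid \<Rightarrow> bool"
  where "skew_algebroid M A \<longleftrightarrow>
    vector_bundle M A \<and>
    bundle_hom M A (tangent_bundle M) (anchor A) \<and>
    (\<forall>X\<in>sections M A. \<forall>Y\<in>sections M A. bracket A X Y \<in> sections M A) \<and>
    bilinear_on_set (sections M A) (bracket A) \<and>
    (\<forall>X\<in>sections M A. \<forall>Y\<in>sections M A. bracket A X Y = - bracket A Y X) \<and>
    (\<forall>X\<in>sections M A. \<forall>Y\<in>sections M A. \<forall>f\<in>C_infinity M.
      bracket A X (f \<odot> Y) = f \<odot> bracket A X Y + anchor_deriv A X f \<odot> Y)"


section \<open>Metrics and connections\<close>

definition pseudo_riemannian_metric ::
  "('m, 'e::real_normed_vector) atlas \<Rightarrow>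
   ('m, 'v::real_vector, 'f::real_normed_vector) algebroid \<Rightarrow> ('m \<Rightarrow> 'v \<Rightarrow> 'v \<Rightarrow> real) \<Rightarrow> bool"
  where "pseudo_riemannian_metric M A g \<longleftrightarrow>
    (\<forall>x. bilinear_on_set (fibre A x) (g x) \<and>
      (\<forall>a\<in>fibre A x. \<forall>b\<in>fibre A x. g x a b = g x b a) \<and>
      (\<forall>a\<in>fibre A x. (\<forall>b\<in>fibre A x. g x a b = 0) \<longrightarrow> a = 0)) \<and>
    (\<forall>(U, \<sigma>)\<in>trivs A. \<forall>v w. smooth_fun_on M U (\<lambda>x. g x (\<sigma> x v) (\<sigma> x w)))"

definition metric_eval ::
  "('m \<Rightarrow> 'v \<Rightarrow> 'v \<Rightarrow> real) \<Rightarrow> ('m \<Rightarrow> 'v) \<Rightarrow> ('m \<Rightarrow> 'v) \<Rightarrow> 'm \<Rightarrow> real"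
  where "metric_eval g X Y = (\<lambda>x. g x (X x) (Y x))"

definition connection ::
  "('m, 'e::real_normed_vector) atlas \<Rightarrow>
   ('m, 'v::real_vector, 'f::real_normed_vector) algebroid \<Rightarrow>
   (('m \<Rightarrow> 'v) \<Rightarrow> ('m \<Rightarrow> 'v) \<Rightarrow> 'm \<Rightarrow> 'v) \<Rightarrow> bool"
  where "connection M A D \<longleftrightarrow>
    (\<forall>X\<in>sections M A. \<forall>Y\<in>sections M A. D X Y \<in> sections M A) \<and>
    bilinear_on_set (sections M A) D \<and>
    (\<forall>X\<in>sections M A. \<forall>Y\<in>sections M A. \<forall>f\<in>C_infinity M.
      D (f \<odot> X) Y = f \<odot> D X Y \<and>
      D X (f \<odot> Y) = f \<odot> D X Y + anchor_deriv A X f \<odot> Y)"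

definition torsion ::
  "('m, 'v::real_vector, 'f) algebroid \<Rightarrow> (('m \<Rightarrow> 'v) \<Rightarrow> ('m \<Rightarrow> 'v) \<Rightarrow> 'm \<Rightarrow> 'v) \<Rightarrow>
   ('m \<Rightarrow> 'v) \<Rightarrow> ('m \<Rightarrow> 'v) \<Rightarrow> 'm \<Rightarrow> 'v"
  where "torsion A D X Y = D X Y - D Y X - bracket A X Y"

definition metric_deriv ::
  "('m, 'v, 'f) algebroid \<Rightarrow> (('m \<Rightarrow> 'v) \<Rightarrow> ('m \<Rightarrow> 'v) \<Rightarrow> 'm \<Rightarrow> 'v) \<Rightarrow>
   ('m \<Rightarrow> 'v \<Rightarrow> 'v \<Rightarrow> real) \<Rightarrow> ('m \<Rightarrow> 'v) \<Rightarrow> ('m \<Rightarrow> 'v) \<Rightarrow> ('m \<Rightarrow> 'v) \<Rightarrow> 'm \<Rightarrow> real"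
  where "metric_deriv A D g X Y Z =
    anchor_deriv A X (metric_eval g Y Z) - metric_eval g (D X Y) Z - metric_eval g Y (D X Z)"

definition levi_civita ::
  "('m, 'e::real_normed_vector) atlas \<Rightarrow>
   ('m, 'v::real_vector, 'f::real_normed_vector) algebroid \<Rightarrow> ('m \<Rightarrow> 'v \<Rightarrow> 'v \<Rightarrow> real) \<Rightarrow>
   (('m \<Rightarrow> 'v) \<Rightarrow> ('m \<Rightarrow> 'v) \<Rightarrow> 'm \<Rightarrow> 'v) \<Rightarrow> bool"
  where "levi_civita M A g D \<longleftrightarrow>
    connection M A D \<and>
    (\<forall>X\<in>sections M A. \<forall>Y\<in>sections M A. torsion A D X Y = 0) \<and>
    (\<forall>X\<in>sections M A. \<forall>Y\<in>sections M A. \<forall>Z\<in>sections M A. metric_deriv A D g X Y Z = 0)"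


section \<open>The symmetric product\<close>

text \<open>
  Sections of the dual bundle are represented by their action on sections, as
  \<open>C\<^sup>\<infinity>(M)\<close>-linear maps from sections to functions.
\<close>

type_synonym ('m, 'v) form = "('m \<Rightarrow> 'v) \<Rightarrow> 'm \<Rightarrow> real"

definition flat :: "('m \<Rightarrow> 'v \<Rightarrow> 'v \<Rightarrow> real) \<Rightarrow> ('m \<Rightarrow> 'v) \<Rightarrow> ('m, 'v) form"
  where "flat g X = (\<lambda>Y. metric_eval g X Y)"

definition sharp ::
  "('m, 'e::real_normed_vector) atlas \<Rightarrow> ('m, 'v, 'f::real_normed_vector) algebroid \<Rightarrow>
   ('m \<Rightarrow> 'v \<Rightarrow> 'v \<Rightarrow> real) \<Rightarrow> ('m, 'v) form \<Rightarrow> 'm \<Rightarrow> 'v"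
  where "sharp M A g \<omega> =
    (THE Z. Z \<in> sections M A \<and> (\<forall>X\<in>sections M A. metric_eval g Z X = \<omega> X))"

definition alt_diff :: "('m, 'v, 'f) algebroid \<Rightarrow> ('m \<Rightarrow> real) \<Rightarrow> ('m, 'v) form"
  where "alt_diff A f = (\<lambda>X. anchor_deriv A X f)"

definition alt_lie ::
  "('m, 'v, 'f) algebroid \<Rightarrow> ('m \<Rightarrow> 'v) \<Rightarrow> ('m, 'v) form \<Rightarrow> ('m, 'v) form"
  where "alt_lie A X \<omega> = (\<lambda>Y. anchor_deriv A X (\<omega> Y) - \<omega> (bracket A X Y))"

definition sym_product ::
  "('m, 'e::real_normed_vector) atlas \<Rightarrow> ('m, 'v, 'f::real_normed_vector) algebroid \<Rightarrow>
   ('m \<Rightarrow> 'v \<Rightarrow> 'v \<Rightarrow> real) \<Rightarrow> ('m \<Rightarrow> 'v) \<Rightarrow> ('m \<Rightarrow> 'v) \<Rightarrow> 'm \<Rightarrow> 'v"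
  where "sym_product M A g X Y = sharp M A g
    (alt_lie A X (flat g Y) + alt_lie A Y (flat g X) - alt_diff A (metric_eval g X Y))"

end

theory Submission
  imports Defs "HOL-Real_Asymp.Real_Asymp"
begin

text \<open>
  For fixed sections \<open>X, Y\<close> let
  \<open>K(Z) = (\<L>\<^sub>X Y\<^sup>\<flat> + \<L>\<^sub>Y X\<^sup>\<flat> - d(g(X,Y)))(Z)\<close>.

  If a torsion-free metric connection \<open>D\<close> is given, substituting \<open>[U,V] = D\<^sub>U V - D\<^sub>V U\<close> and
  \<open>\<rho>(U)(g(V,W)) = g(D\<^sub>U V, W) + g(V, D\<^sub>U W)\<close> into \<open>K\<close> makes everything cancel except
  \<open>g(D\<^sub>X Y + D\<^sub>Y X, Z)\<close>. A section is determined by its products with all sections, so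
  \<open>\<langle>X : Y\<rangle> = D\<^sub>X Y + D\<^sub>Y X = 2 D\<^sub>X Y - [X,Y]\<close>; this is Koszul's formula.

  Conversely, \<open>\<langle>X : Y\<rangle>\<close> is symmetric and satisfies
  \<open>\<langle>f X : Y\<rangle> = f \<langle>X : Y\<rangle> + \<rho>(Y)(f) X\<close>. Its symmetric derivative term cancels the skew one
  of the bracket in the first argument and doubles it in the second, so the formula defines a
  connection. Its torsion vanishes because the symmetric part drops out, and \<open>\<nabla>g = 0\<close> because
  \<open>g([X,Y],Z) + K\<^sub>X\<^sub>Y(Z) + g([X,Z],Y) + K\<^sub>X\<^sub>Z(Y) = 2 \<rho>(X)(g(Y,Z))\<close>.

  The substance of the converse is that \<open>\<sharp>\<close> is defined on \<open>K\<close>, that is, that every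
  \<open>C\<^sup>\<infinity>(M)\<close>-linear map \<open>\<omega>\<close> from sections to smooth functions has the form \<open>g(Z, \<cdot>)\<close>
  (\<open>form_represented\<close>). Expanding \<open>X\<close> in cut-off local sections shows that \<open>\<omega>(X)\<close> at a point depends
  only on the value of \<open>X\<close> there, and nondegeneracy gives \<open>Z\<close> pointwise. In a trivialisation the coordinates of
  \<open>Z\<close> solve a linear system with smooth coefficients, whose solution is smooth by
  \<open>C_diff_on_solution\<close>. The cut-offs need bump functions on the manifold (\<open>manifold_bump\<close>), and
  the smoothness of \<open>K(Z)\<close> needs that of \<open>\<rho>(X)(f)\<close> (\<open>anchor_deriv_smooth\<close>).
\<close>

section \<open>Finite-dimensional inner product spaces\<close>

text \<open>
  Distinct vectors of \<open>B\<close> are at distance \<open>\<surd>2\<close>, so an infinite \<open>B\<close> would contain a bounded sequence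
  without a convergent subsequence.
\<close>

lemma orthonormal_finite:
  fixes B :: "'a::{real_inner, heine_borel} set"
  assumes "\<And>x. x \<in> B \<Longrightarrow> norm x = 1" "\<And>x y. x \<in> B \<Longrightarrow> y \<in> B \<Longrightarrow> x \<noteq> y \<Longrightarrow> x \<bullet> y = 0"
  shows "finite B"
proof (rule ccontr)
  assume "infinite B"
  then obtain f :: "nat \<Rightarrow> 'a" where f: "inj f" "range f \<subseteq> B"
    using infinite_countable_subset by blast
  have nf: "norm (f n) = 1" for n using f assms(1) by blast
  have "bounded (range f)" unfolding bounded_iff using nf by (intro exI[of _ 1]) auto
  then obtain l r where r: "strict_mono r" "((f \<circ> r) \<longlongrightarrow> l) sequentially"
    using bounded_imp_convergent_subsequence by metis
  have "Cauchy (f \<circ> r)" using r(2) by (rule LIMSEQ_imp_Cauchy)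
  then obtain N where N: "\<And>m n. m \<ge> N \<Longrightarrow> n \<ge> N \<Longrightarrow> dist ((f \<circ> r) m) ((f \<circ> r) n) < 1"
    unfolding Cauchy_def by (metis zero_less_one)
  let ?a = "f (r N)" and ?b = "f (r (Suc N))"
  have "r N \<noteq> r (Suc N)" using strict_monoD[OF r(1), of N "Suc N"] by simp
  then have "?a \<noteq> ?b" using f(1) by (simp add: inj_eq)
  then have o: "?a \<bullet> ?b = 0" using assms(2) f(2) by blast
  have "(norm (?a - ?b))\<^sup>2 = 2"
    using o nf[of "r N"] nf[of "r (Suc N)"] by (simp add: power2_norm_eq_inner inner_diff inner_commute norm_eq_1)
  moreover have "norm (?a - ?b) < 1" using N[of N "Suc N"] by (simp add: dist_norm)
  then have "(norm (?a - ?b))\<^sup>2 < 1" by (simp add: power_less_one_iff)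
  ultimately show False by simp
qed

text \<open>
  A finite family that expands vectors like an orthonormal basis, with inner products as
  coordinates; its elements may be linearly dependent. It takes the place of the canonical basis of a
  Euclidean space, which would exclude the zero space.
\<close>

definition parseval_frame :: "'a::{real_inner, heine_borel} set"
  where "parseval_frame = (SOME B. finite B \<and> (\<forall>x. (\<Sum>b\<in>B. (x \<bullet> b) *\<^sub>R b) = x))"

text \<open>
  A maximal orthonormal set will do: it is finite, and the difference of a vector and its orthogonal projection
  to the span would, if nonzero, enlarge the set.
\<close>

lemma parseval_frame_exists:
  "\<exists>B::'a::{real_inner, heine_borel} set. finite B \<and> (\<forall>x. (\<Sum>b\<in>B. (x \<bullet> b) *\<^sub>R b) = x)"
proof -
  define P where "P = {B::'a set. (\<forall>x\<in>B. norm x = 1) \<and> (\<forall>x\<in>B. \<forall>y\<in>B. x \<noteq> y \<longrightarrow> x \<bullet> y = 0)}"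
  have "\<exists>M\<in>P. \<forall>X\<in>P. M \<subseteq> X \<longrightarrow> X = M"
  proof (rule subset_Zorn')
    fix C assume C: "subset.chain P C"
    then have C': "C \<subseteq> P" "\<And>X Y. X \<in> C \<Longrightarrow> Y \<in> C \<Longrightarrow> X \<subseteq> Y \<or> Y \<subseteq> X"
      by (auto simp: subset.chain_def)
    show "\<Union>C \<in> P"
      unfolding P_def
    proof (safe)
      fix x X assume "x \<in> X" "X \<in> C" then show "norm x = 1" using C'(1) P_def by auto
    next
      fix x X y Y assume *: "x \<in> X" "X \<in> C" "y \<in> Y" "Y \<in> C" "x \<noteq> y"
      then obtain Z where "Z \<in> C" "x \<in> Z" "y \<in> Z" using C'(2)[of X Y] by blast
      then show "x \<bullet> y = 0" using C'(1) * P_def by auto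
    qed
  qed
  then obtain B where B: "B \<in> P" "\<And>X. X \<in> P \<Longrightarrow> B \<subseteq> X \<Longrightarrow> X = B" by blast
  have n: "x \<bullet> x = 1" if "x \<in> B" for x using that B(1) by (simp add: P_def norm_eq_1)
  have o: "x \<bullet> y = 0" if "x \<in> B" "y \<in> B" "x \<noteq> y" for x y using that B(1) by (simp add: P_def)
  have fin: "finite B" using orthonormal_finite[of B] B(1) by (auto simp: P_def)
  have "(\<Sum>b\<in>B. (x \<bullet> b) *\<^sub>R b) = x" for x
  proof (rule ccontr)
    define y where "y = x - (\<Sum>b\<in>B. (x \<bullet> b) *\<^sub>R b)"
    assume "(\<Sum>b\<in>B. (x \<bullet> b) *\<^sub>R b) \<noteq> x"
    then have y0: "y \<noteq> 0" by (auto simp: y_def)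
    have yo: "y \<bullet> c = 0" if c: "c \<in> B" for c
    proof -
      have "(\<Sum>b\<in>B. (x \<bullet> b) * (b \<bullet> c)) = (\<Sum>b\<in>B. if b = c then x \<bullet> c else 0)"
        by (rule sum.cong) (auto simp: n o c)
      then show ?thesis using c fin by (simp add: y_def inner_diff_left inner_sum_left sum.delta)
    qed
    let ?u = "(1 / norm y) *\<^sub>R y"
    have nu: "norm ?u = 1" using y0 by simp
    have uo: "?u \<bullet> c = 0" "c \<bullet> ?u = 0" if "c \<in> B" for c
      using yo[OF that] by (simp_all add: inner_commute)
    have "insert ?u B \<in> P"
      using B(1) nu uo unfolding P_def by auto
    then have "?u \<in> B" using B(2)[of "insert ?u B"] by auto
    then show False using uo(1)[of ?u] nu by (simp add: norm_eq_1 del: inner_scaleR_left inner_scaleR_right)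
  qed
  with fin show ?thesis by blast
qed

lemma finite_parseval_frame [simp]: "finite (parseval_frame::'a::{real_inner, heine_borel} set)"
  and parseval_frame_expand: "(\<Sum>b\<in>parseval_frame. (x \<bullet> b) *\<^sub>R b) = (x::'a)"
  using someI_ex[OF parseval_frame_exists[where 'a='a]] unfolding parseval_frame_def by auto

lemma linear_parseval_frame_expand:
  fixes f :: "'a::{real_inner, heine_borel} \<Rightarrow> 'b::real_vector"
  assumes "linear f"
  shows "f x = (\<Sum>b\<in>parseval_frame. (x \<bullet> b) *\<^sub>R f b)"
proof -
  have "f x = f (\<Sum>b\<in>parseval_frame. (x \<bullet> b) *\<^sub>R b)" by (simp add: parseval_frame_expand)
  then show ?thesis using assms by (simp add: linear_sum linear_cmul)
qed

lemma linear_imp_bounded_linear: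
  fixes f :: "'a::{real_inner, heine_borel} \<Rightarrow> 'b::real_normed_vector"
  assumes "linear f" shows "bounded_linear f"
proof -
  have "f = (\<lambda>x. \<Sum>b\<in>parseval_frame. (x \<bullet> b) *\<^sub>R f b)" using linear_parseval_frame_expand[OF assms] by blast
  moreover have "bounded_linear (\<lambda>x. \<Sum>b\<in>parseval_frame. (x \<bullet> b) *\<^sub>R f b)"
    by (intro bounded_linear_sum bounded_linear_scaleR_const bounded_linear_inner_left)
  ultimately show ?thesis by simp
qed

lemma finite_dim_inj_imp_surj:
  fixes f :: "'a::{real_inner, heine_borel} \<Rightarrow> 'a"
  assumes f: "linear f" "inj f" shows "surj f"
proof -
  have sp: "span (parseval_frame::'a set) = UNIV"
  proof -
    have "x \<in> span parseval_frame" for x :: 'a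
      by (subst parseval_frame_expand[of x, symmetric]) (intro span_sum span_scale span_base)
    then show ?thesis by auto
  qed
  obtain B :: "'a set" where B: "B \<subseteq> parseval_frame" "independent B" "parseval_frame \<subseteq> span B"
    using maximal_independent_subset by blast
  have fB: "finite B" using B(1) finite_parseval_frame finite_subset by blast
  have spB: "span B = UNIV" using sp B(3) by (metis span_minimal subspace_span top.extremum_uniqueI)
  have ind: "independent (f ` B)"
    using B(2) f by (simp add: linear_independent_injective_image inj_on_subset)
  have card: "card (f ` B) = card B" using f(2) by (simp add: card_image inj_on_subset)
  have "y \<in> span (f ` B)" for y
  proof (rule ccontr)
    assume y: "y \<notin> span (f ` B)"
    then have i: "independent (insert y (f ` B))" using ind by (simp add: independent_insert)
    have "insert y (f ` B) \<subseteq> span B" unfolding spB by (rule subset_UNIV)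
    then have "card (insert y (f ` B)) \<le> card B"
      by (rule independent_span_bound[OF fB i, THEN conjunct2])
    moreover have "y \<notin> f ` B" using y span_base[of y "f ` B"] by blast
    ultimately show False using fB card by simp
  qed
  then have "UNIV = f ` span B" using linear_span_image[OF f(1), of B] by auto
  then show ?thesis using spB by simp
qed

section \<open>Calculus of smooth maps\<close>

lemma C_diff_on_cong:
  assumes "open S" "\<And>x. x \<in> S \<Longrightarrow> f x = g x" "C_diff_on k S f"
  shows "C_diff_on k S g"
  using assms(2,3)
proof (induction k arbitrary: f g)
  case 0
  then show ?case by (metis C_diff_on.simps(1) continuous_on_cong)
next
  case (Suc k)
  have d: "f differentiable at x" if "x \<in> S" for x using Suc.prems that by simp
  have "frechet_derivative f (at x) = frechet_derivative g (at x)" if "x \<in> S" for x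
    using frechet_derivative_transform_within_open[OF d[OF that] assms(1) that] Suc.prems(1) by blast
  then have "C_diff_on k S (\<lambda>x. frechet_derivative g (at x) v)" for v
    using Suc.IH[of "\<lambda>x. frechet_derivative f (at x) v"] Suc.prems by simp
  moreover have "g differentiable at x" if "x \<in> S" for x
    using d[OF that] Suc.prems(1) that assms(1)
    by (meson differentiable_def has_derivative_transform_within_open)
  ultimately show ?case by simp
qed

lemma C_diff_on_mono: "C_diff_on k S f \<Longrightarrow> T \<subseteq> S \<Longrightarrow> C_diff_on k T f"
  by (induction k arbitrary: f) (auto intro: continuous_on_subset)

lemma C_diff_on_SucI:
  assumes "open S" "\<And>x. x \<in> S \<Longrightarrow> (f has_derivative f' x) (at x)"
    and "\<And>v. C_diff_on k S (\<lambda>x. f' x v)"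
  shows "C_diff_on (Suc k) S f"
proof -
  have "frechet_derivative f (at x) = f' x" if "x \<in> S" for x
    using frechet_derivative_at[OF assms(2)[OF that]] by simp
  then have "C_diff_on k S (\<lambda>x. frechet_derivative f (at x) v)" for v
    by (intro C_diff_on_cong[OF assms(1) _ assms(3)]) simp
  then show ?thesis using assms(2) by (auto simp: differentiable_def)
qed

lemma C_diff_on_SucD:
  assumes "C_diff_on (Suc k) S f"
  shows "\<And>x. x \<in> S \<Longrightarrow> (f has_derivative frechet_derivative f (at x)) (at x)"
    and "\<And>v. C_diff_on k S (\<lambda>x. frechet_derivative f (at x) v)"
  using assms frechet_derivative_works by auto

lemma C_diff_on_Suc_imp:
  "C_diff_on (Suc k) S f \<Longrightarrow> C_diff_on k S f"
proof (induction k arbitrary: f)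
  case 0
  then show ?case
    by (auto intro!: continuous_at_imp_continuous_on differentiable_imp_continuous_within)
next
  case (Suc k)
  then show ?case by (metis C_diff_on.simps(2))
qed

lemma C_diff_on_local:
  assumes "\<And>x. x \<in> S \<Longrightarrow> \<exists>T. open T \<and> x \<in> T \<and> C_diff_on k T f"
  shows "C_diff_on k S f"
  using assms
proof (induction k arbitrary: f)
  case 0
  then show ?case
    by (metis C_diff_on.simps(1) continuous_at_imp_continuous_on continuous_on_eq_continuous_at)
next
  case (Suc k)
  have "f differentiable at x" if "x \<in> S" for x using Suc.prems[OF that] by auto
  moreover have "C_diff_on k S (\<lambda>x. frechet_derivative f (at x) v)" for v
    by (rule Suc.IH) (use Suc.prems in fastforce)
  ultimately show ?case by simp
qed

lemma C_diff_on_const [simp]: "C_diff_on k S (\<lambda>x. c)"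
  by (induction k arbitrary: c) auto

lemma C_diff_on_linear:
  assumes S: "open S" and h: "bounded_linear h" and f: "C_diff_on k S f"
  shows "C_diff_on k S (\<lambda>x. h (f x))"
  using f
proof (induction k arbitrary: f)
  case 0
  then show ?case using h by (simp add: bounded_linear.continuous_on)
next
  case (Suc k)
  note f = C_diff_on_SucD[OF Suc.prems]
  show ?case
    by (rule C_diff_on_SucI[OF S bounded_linear.has_derivative[OF h f(1)]]) (auto intro: Suc.IH f(2))
qed

lemma C_diff_on_id: "open S \<Longrightarrow> C_diff_on k S (\<lambda>x. x)"
  by (cases k) (auto intro!: C_diff_on_SucI[where f'="\<lambda>_ v. v"] simp del: C_diff_on.simps(2))

lemma C_diff_on_add:
  assumes S: "open S" and "C_diff_on k S f" "C_diff_on k S g"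
  shows "C_diff_on k S (\<lambda>x. f x + g x)"
  using assms(2,3)
proof (induction k arbitrary: f g)
  case 0
  then show ?case by (simp add: continuous_on_add)
next
  case (Suc k)
  note f = C_diff_on_SucD[OF Suc.prems(1)] and g = C_diff_on_SucD[OF Suc.prems(2)]
  show ?case
    by (rule C_diff_on_SucI[OF S has_derivative_add[OF f(1) g(1)]]) (auto intro: Suc.IH f(2) g(2))
qed

lemma C_diff_on_sum:
  assumes S: "open S" and "\<And>i. i \<in> I \<Longrightarrow> C_diff_on k S (f i)"
  shows "C_diff_on k S (\<lambda>x. \<Sum>i\<in>I. f i x)"
  using assms(2) by (induction I rule: infinite_finite_induct) (auto intro: C_diff_on_add[OF S])

lemma C_diff_on_bilinear:
  assumes S: "open S" and P: "bounded_bilinear P" and "C_diff_on k S f" "C_diff_on k S g"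
  shows "C_diff_on k S (\<lambda>x. P (f x) (g x))"
  using assms(3,4)
proof (induction k arbitrary: f g)
  case 0
  then show ?case using bounded_bilinear.continuous_on[OF P] by simp
next
  case (Suc k)
  note f = C_diff_on_SucD[OF Suc.prems(1)] and g = C_diff_on_SucD[OF Suc.prems(2)]
  note lower = Suc.prems[THEN C_diff_on_Suc_imp]
  show ?case
    by (rule C_diff_on_SucI[OF S bounded_bilinear.FDERIV[OF P f(1) g(1)]])
      (auto intro!: C_diff_on_add[OF S] Suc.IH f(2) g(2) lower)
qed

lemmas C_diff_on_scaleR = C_diff_on_bilinear[OF _ bounded_bilinear_scaleR]

lemma C_diff_on_minus:
  assumes "open S" "C_diff_on k S f" "C_diff_on k S g"
  shows "C_diff_on k S (\<lambda>x. f x - g x)"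
  using C_diff_on_add[OF assms(1,2) C_diff_on_linear[OF assms(1) bounded_linear_minus[OF bounded_linear_ident] assms(3)]]
  by simp

text \<open>
  A family of linear maps is smooth once it is smooth on each fixed vector: expanding the
  argument in the Parseval frame turns the application into a finite sum of products.
\<close>

lemma C_diff_on_apply:
  fixes T :: "'e::real_normed_vector \<Rightarrow> 'f::{real_inner, heine_borel} \<Rightarrow> 'h::real_normed_vector"
  assumes S: "open S" and lin: "\<And>x. x \<in> S \<Longrightarrow> linear (T x)"
    and T: "\<And>v. C_diff_on k S (\<lambda>x. T x v)" and u: "C_diff_on k S u"
  shows "C_diff_on k S (\<lambda>x. T x (u x))"
proof (rule C_diff_on_cong[OF S])
  show "(\<Sum>b\<in>parseval_frame. (u x \<bullet> b) *\<^sub>R T x b) = T x (u x)" if "x \<in> S" for x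
    using linear_parseval_frame_expand[OF lin[OF that]] by metis
  show "C_diff_on k S (\<lambda>x. \<Sum>b\<in>parseval_frame. (u x \<bullet> b) *\<^sub>R T x b)"
    by (intro C_diff_on_sum C_diff_on_scaleR S T C_diff_on_linear[OF S bounded_linear_inner_left u])
qed

text \<open>
  The derivative of \<open>g \<circ> f\<close> in direction \<open>v\<close> is the linear map \<open>Dg(f x)\<close> applied to the moving vector
  \<open>Df(x) v\<close>; so the induction step is \<open>C_diff_on_apply\<close>.
\<close>

lemma C_diff_on_compose:
  fixes f :: "'e::real_normed_vector \<Rightarrow> 'f::{real_inner, heine_borel}" and g :: "'f \<Rightarrow> 'h::real_normed_vector"
  assumes S: "open S" and T: "open T" and fST: "f ` S \<subseteq> T"
    and "C_diff_on k S f" "C_diff_on k T g"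
  shows "C_diff_on k S (\<lambda>x. g (f x))"
  using assms(4,5)
proof (induction k arbitrary: g)
  case 0
  then show ?case using fST by (auto intro: continuous_on_compose2)
next
  case (Suc k)
  note f = C_diff_on_SucD[OF Suc.prems(1)] and g = C_diff_on_SucD[OF Suc.prems(2)]
  have fx: "f x \<in> T" if "x \<in> S" for x using fST that by auto
  show ?case
  proof (rule C_diff_on_SucI[OF S])
    show "((\<lambda>x. g (f x)) has_derivative
        (\<lambda>v. frechet_derivative g (at (f x)) (frechet_derivative f (at x) v))) (at x)" if "x \<in> S" for x
      using diff_chain_at[OF f(1)[OF that] g(1)[OF fx[OF that]]] by (simp add: o_def)
    show "C_diff_on k S (\<lambda>x. frechet_derivative g (at (f x)) (frechet_derivative f (at x) v))" for v
    proof (rule C_diff_on_apply[OF S])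
      show "linear (frechet_derivative g (at (f x)))" if "x \<in> S" for x
        by (rule has_derivative_linear[OF g(1)[OF fx[OF that]]])
      show "C_diff_on k S (\<lambda>x. frechet_derivative g (at (f x)) w)" for w
        by (rule Suc.IH[OF C_diff_on_Suc_imp[OF Suc.prems(1)] g(2)])
    qed (rule f(2))
  qed
qed

section \<open>Bump functions\<close>

text \<open>
  All derivatives of the smooth function that is \<open>0\<close> for \<open>t \<le> 0\<close> and \<open>exp(-1/t)\<close> for \<open>t > 0\<close> are
  linear combinations of the functions of this family, which makes smoothness a plain induction.
\<close>

definition flat_exp :: "nat \<Rightarrow> real \<Rightarrow> real"
  where "flat_exp n t = (if t \<le> 0 then 0 else inverse t ^ n * exp (- inverse t))"

lemma flat_exp_tendsto: "((\<lambda>t. flat_exp n t) \<longlongrightarrow> 0) (at 0)"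
proof -
  have "((\<lambda>t::real. inverse t ^ n * exp (- inverse t)) \<longlongrightarrow> 0) (at_right 0)"
    by real_asymp
  then have r: "((\<lambda>t. flat_exp n t) \<longlongrightarrow> 0) (at_right 0)"
    by (rule Lim_transform_eventually) (auto simp: flat_exp_def eventually_at_filter)
  have "((\<lambda>t. flat_exp n t) \<longlongrightarrow> 0) (at_left 0)"
    by (rule Lim_transform_eventually[OF tendsto_const]) (auto simp: flat_exp_def eventually_at_filter)
  with r show ?thesis by (simp add: filterlim_split_at)
qed

lemma flat_exp_deriv:
  "(flat_exp n has_real_derivative (flat_exp (n + 2) t - real n * flat_exp (n + 1) t)) (at t)"
proof -
  consider "t < 0" | "t = 0" | "t > 0" by linarith
  then show ?thesis
  proof cases
    case 1
    have "((\<lambda>_. 0) has_real_derivative 0) (at t)" by simp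
    then have "(flat_exp n has_real_derivative 0) (at t)"
      by (rule DERIV_cong_ev[THEN iffD1, rotated -1])
        (use 1 in \<open>auto intro!: eventually_nhds_in_open[of "{..<0}", THEN eventually_mono] simp: flat_exp_def\<close>)
    then show ?thesis using 1 by (simp add: flat_exp_def)
  next
    case 2
    \<comment> \<open>The difference quotient at 0 is the next member of the family.\<close>
    have "((\<lambda>h. (flat_exp n (0 + h) - flat_exp n 0) / h) \<longlongrightarrow> 0) (at 0)"
      by (rule Lim_transform_eventually[OF flat_exp_tendsto[of "Suc n"]])
        (auto simp: flat_exp_def eventually_at_filter field_simps)
    then show ?thesis using 2 by (simp add: DERIV_def flat_exp_def)
  next
    case 3
    let ?i = "inverse t" and ?e = "exp (- inverse t)"
    have "((\<lambda>t. inverse t ^ n * exp (- inverse t)) has_real_derivative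
        (?i ^ n * (?e * (?i * ?i)) - real n * ?i ^ (n - 1) * (?i * ?i) * ?e)) (at t)"
      using 3 by (auto intro!: derivative_eq_intros simp: power2_eq_square)
    also have "?i ^ n * (?e * (?i * ?i)) - real n * ?i ^ (n - 1) * (?i * ?i) * ?e =
        flat_exp (n + 2) t - real n * flat_exp (n + 1) t"
      using 3 by (cases n) (simp_all add: flat_exp_def algebra_simps)
    finally show ?thesis
      by (rule DERIV_cong_ev[THEN iffD1, rotated -1])
        (use 3 in \<open>auto intro!: eventually_nhds_in_open[of "{0<..}", THEN eventually_mono] simp: flat_exp_def\<close>)
  qed
qed

lemma flat_exp_C_diff: "C_diff_on k UNIV (flat_exp n)"
proof (induction k arbitrary: n)
  case 0
  then show ?case
    using DERIV_isCont[OF flat_exp_deriv] by (auto intro!: continuous_at_imp_continuous_on)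
next
  case (Suc k)
  show ?case
    by (rule C_diff_on_SucI[OF open_UNIV flat_exp_deriv[THEN has_field_derivative_imp_has_derivative]])
      (auto intro!: C_diff_on_minus C_diff_on_bilinear[OF _ bounded_bilinear_mult] Suc.IH)
qed

lemma bump_exists:
  fixes p :: "'e::{real_inner, heine_borel}"
  assumes "r > 0"
  shows "\<exists>b::'e \<Rightarrow> real. smooth_on UNIV b \<and> (\<forall>x\<in>ball p r. b x \<noteq> 0) \<and> (\<forall>x. x \<notin> ball p r \<longrightarrow> b x = 0)"
proof (intro exI conjI)
  let ?b = "\<lambda>x. flat_exp 0 (r\<^sup>2 - (x - p) \<bullet> (x - p))"
  show "smooth_on UNIV ?b"
    unfolding smooth_on_def
    by (intro allI C_diff_on_compose[OF _ _ _ _ flat_exp_C_diff] C_diff_on_minus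
        C_diff_on_bilinear[OF _ bounded_bilinear_inner] C_diff_on_id C_diff_on_const) auto
  have "(x - p) \<bullet> (x - p) < r\<^sup>2 \<longleftrightarrow> norm (x - p) < r" for x
    using assms power2_less_imp_less[of "norm (x - p)" r] power_strict_mono[of "norm (x - p)" r 2]
    by (auto simp: power2_norm_eq_inner)
  then have "r\<^sup>2 - (x - p) \<bullet> (x - p) \<le> 0 \<longleftrightarrow> x \<notin> ball p r" for x
    by (simp add: dist_norm norm_minus_commute flip: not_less)
  then show "\<forall>x\<in>ball p r. ?b x \<noteq> 0" "\<forall>x. x \<notin> ball p r \<longrightarrow> ?b x = 0"
    by (simp_all add: flat_exp_def)
qed

section \<open>Smooth solutions of linear systems\<close>

text \<open>
  The product rule for a factor \<open>h\<close> that is merely continuous: \<open>h F\<close> differs from \<open>h(x) F\<close> by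
  \<open>(h - h(x)) F\<close>, which is \<open>o(|y - x|)\<close> because \<open>F\<close> vanishes at \<open>x\<close> and is differentiable. It lets the
  solution of a linear system, known only to be continuous, appear in its own difference quotient.
\<close>

lemma has_derivative_scaleR_null:
  fixes F :: "'e::real_normed_vector \<Rightarrow> 'b::real_normed_vector"
  assumes h: "isCont h x" and F: "(F has_derivative F') (at x)" and F0: "F x = 0"
  shows "((\<lambda>y. h y *\<^sub>R F y) has_derivative (\<lambda>v. h x *\<^sub>R F' v)) (at x)"
proof -
  obtain B where B: "B > 0" "\<And>v. norm (F' v) \<le> norm v * B"
    using bounded_linear.pos_bounded[OF has_derivative_bounded_linear[OF F]] by blast
  obtain d1 where d1: "d1 > 0" "\<And>y. norm (y - x) < d1 \<Longrightarrow> norm (F y - F x - F' (y - x)) \<le> 1 * norm (y - x)"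
    using F unfolding has_derivative_at_alt by (metis zero_less_one)
  have bd: "norm (F y) \<le> (1 + B) * norm (y - x)" if "norm (y - x) < d1" for y
  proof -
    have "norm (F y) \<le> norm (F y - F x - F' (y - x)) + norm (F' (y - x))"
      using norm_triangle_sub[of "F y" "F' (y - x)"] F0 by simp
    also have "\<dots> \<le> (1 + B) * norm (y - x)"
      using d1(2)[OF that] B(2)[of "y - x"] by (simp add: algebra_simps)
    finally show ?thesis .
  qed
  have "((\<lambda>y. (h y - h x) *\<^sub>R F y) has_derivative (\<lambda>v. 0)) (at x)"
    unfolding has_derivative_at_alt
  proof (intro conjI allI impI bounded_linear_zero)
    fix e :: real assume e: "e > 0"
    then have "e / (1 + B) > 0" using B by simp
    then obtain d2 where d2: "d2 > 0" "\<And>y. dist y x < d2 \<Longrightarrow> dist (h y) (h x) < e / (1 + B)"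
      using h unfolding continuous_at_eps_delta by meson
    show "\<exists>d>0. \<forall>y. norm (y - x) < d \<longrightarrow>
        norm ((h y - h x) *\<^sub>R F y - (h x - h x) *\<^sub>R F x - 0) \<le> e * norm (y - x)"
    proof (intro exI[of _ "min d1 d2"] conjI allI impI)
      fix y assume y: "norm (y - x) < min d1 d2"
      have "\<bar>h y - h x\<bar> * norm (F y) \<le> e / (1 + B) * ((1 + B) * norm (y - x))"
        by (rule mult_mono) (use y d2(2)[of y] bd[of y] e B in \<open>auto simp: dist_norm\<close>)
      then show "norm ((h y - h x) *\<^sub>R F y - (h x - h x) *\<^sub>R F x - 0) \<le> e * norm (y - x)"
        using B(1) by simp
    qed (use d1 d2 in simp)
  qed
  from has_derivative_add[OF this bounded_linear.has_derivative[OF bounded_linear_scaleR_right F, of "h x"]]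
  show ?thesis by (simp add: algebra_simps)
qed

lemma linear_system_inverse:
  fixes T :: "'f::{real_inner, heine_borel} \<Rightarrow> 'f"
  assumes "linear T" "inj T"
  obtains L where "bounded_linear L" "\<And>v. L (T v) = v" "\<And>v. T (L v) = v"
proof -
  obtain L where L: "linear L" "L \<circ> T = id" using linear_injective_left_inverse[OF assms] by blast
  have 1: "L (T v) = v" for v using L(2) by (metis comp_apply id_apply)
  have "T (L v) = v" for v
    using finite_dim_inj_imp_surj[OF assms] 1 by (metis surjD)
  with 1 that linear_imp_bounded_linear[OF L(1)] show ?thesis by blast
qed

text \<open>
  Injectivity at \<open>x\<close> bounds \<open>|v|\<close> by a multiple of \<open>|T\<^sub>y v|\<close>, uniformly for \<open>y\<close> near \<open>x\<close>. For
  \<open>v = z(y) - z(x)\<close> the vector \<open>T\<^sub>y v = r(y) - T\<^sub>y z(x)\<close> tends to \<open>r(x) - T\<^sub>x z(x) = 0\<close>.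
\<close>

lemma solution_continuous:
  fixes T :: "'e::real_normed_vector \<Rightarrow> 'f::{real_inner, heine_borel} \<Rightarrow> 'f"
  assumes S: "open S" "x \<in> S" and lin: "\<And>x. x \<in> S \<Longrightarrow> linear (T x)" and inj: "\<And>x. x \<in> S \<Longrightarrow> inj (T x)"
    and T: "\<And>v. continuous_on S (\<lambda>x. T x v)" and r: "continuous_on S r"
    and z: "\<And>x. x \<in> S \<Longrightarrow> T x (z x) = r x"
  shows "isCont z x"
proof -
  obtain L where L: "bounded_linear L" "\<And>v. L (T x v) = v" 
    using linear_system_inverse[OF lin[OF S(2)] inj[OF S(2)]] by metis
  obtain K where K: "K > 0" "\<And>v. norm (L v) \<le> norm v * K"
    using bounded_linear.pos_bounded[OF L(1)] by blast
  have cT: "isCont (\<lambda>y. T y v) x" for v using T S continuous_on_eq_continuous_at by blast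
  have cr: "isCont r x" using r S continuous_on_eq_continuous_at by blast
  \<comment> \<open>A bound for the operator norm of \<open>T y - T x\<close> that is visibly continuous in \<open>y\<close>.\<close>
  define \<delta> where "\<delta> y = (\<Sum>b\<in>parseval_frame. norm b * norm (T y b - T x b))" for y
  have "isCont \<delta> x" unfolding \<delta>_def by (intro continuous_intros cT)
  then have "(\<delta> \<longlongrightarrow> \<delta> x) (at x)" by (simp add: isCont_def)
  then have "(\<delta> \<longlongrightarrow> 0) (at x)" by (simp add: \<delta>_def)
  then have "eventually (\<lambda>y. \<delta> y < 1 / (2 * K)) (at x)" using K(1) by (intro order_tendstoD) auto
  moreover have "eventually (\<lambda>y. y \<in> S) (at x)" using S eventually_at_topological by blast
  ultimately have "eventually (\<lambda>y. norm (z y - z x) \<le> 2 * K * norm (r y - T y (z x))) (at x)"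
  proof eventually_elim
    case (elim y)
    let ?v = "z y - z x"
    have "norm (T y ?v - T x ?v) = norm (\<Sum>b\<in>parseval_frame. (?v \<bullet> b) *\<^sub>R (T y b - T x b))"
      unfolding linear_parseval_frame_expand[OF lin[OF elim(2)], of ?v] linear_parseval_frame_expand[OF lin[OF S(2)], of ?v]
      by (simp add: sum_subtractf scaleR_diff_right)
    also have "\<dots> \<le> (\<Sum>b\<in>parseval_frame. norm ?v * (norm b * norm (T y b - T x b)))"
      by (rule sum_norm_le)
        (auto simp: mult.assoc[symmetric] intro!: mult_right_mono Cauchy_Schwarz_ineq2)
    also have "\<dots> = norm ?v * \<delta> y" by (simp add: \<delta>_def sum_distrib_left)
    also have "\<dots> \<le> norm ?v * (1 / (2 * K))" using elim(1) by (intro mult_left_mono) auto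
    finally have a: "norm (T y ?v - T x ?v) \<le> norm ?v / (2 * K)" by simp
    have "norm ?v \<le> norm (T x ?v) * K" using K(2)[of "T x ?v"] L(2) by simp
    also have "\<dots> \<le> (norm (T y ?v) + norm ?v / (2 * K)) * K"
      using a K(1) norm_triangle_sub[of "T x ?v" "T y ?v"]
      by (intro mult_right_mono) (auto simp: norm_minus_commute)
    finally have "norm ?v \<le> 2 * K * norm (T y ?v)" using K(1) by (simp add: field_simps)
    then show ?case using z[OF elim(2)] linear_diff[OF lin[OF elim(2)]] by simp
  qed
  moreover have "((\<lambda>y. 2 * K * norm (r y - T y (z x))) \<longlongrightarrow> 2 * K * norm (r x - T x (z x))) (at x)"
    using cr cT[of "z x"] unfolding isCont_def by (intro tendsto_intros)
  then have "((\<lambda>y. 2 * K * norm (r y - T y (z x))) \<longlongrightarrow> 0) (at x)" using z[OF S(2)] by simp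
  ultimately have "((\<lambda>y. z y - z x) \<longlongrightarrow> 0) (at x)" by (rule Lim_null_comparison)
  then show ?thesis unfolding isCont_def using LIM_zero_iff by blast
qed

text \<open>
  With the inverse \<open>L\<close> of \<open>T\<^sub>x\<close>, the equation reads \<open>z(y) = L (r(y) - (T\<^sub>y - T\<^sub>x) z(y))\<close>. The right-hand
  side is differentiable at \<open>x\<close> although \<open>z\<close> occurs in it, since the coefficients of \<open>T\<^sub>y - T\<^sub>x\<close>
  vanish there.
\<close>

lemma solution_derivative:
  fixes T :: "'e::real_normed_vector \<Rightarrow> 'f::{real_inner, heine_borel} \<Rightarrow> 'f"
  assumes S: "open S" "x \<in> S" and lin: "\<And>x. x \<in> S \<Longrightarrow> linear (T x)" and inj: "\<And>x. x \<in> S \<Longrightarrow> inj (T x)"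
    and zc: "isCont z x" and T: "\<And>b. ((\<lambda>y. T y b) has_derivative T' b) (at x)" and r: "(r has_derivative r') (at x)"
    and z: "\<And>x. x \<in> S \<Longrightarrow> T x (z x) = r x"
  obtains z' where "(z has_derivative z') (at x)"
    "\<And>v. T x (z' v) = r' v - (\<Sum>b\<in>parseval_frame. (z x \<bullet> b) *\<^sub>R T' b v)"
proof -
  obtain L where L: "bounded_linear L" "\<And>v. L (T x v) = v" "\<And>v. T x (L v) = v"
    using linear_system_inverse[OF lin[OF S(2)] inj[OF S(2)]] by metis
  let ?w = "\<lambda>y. L (r y - (\<Sum>b\<in>parseval_frame. (z y \<bullet> b) *\<^sub>R (T y b - T x b)))"
  have eq: "?w y = z y" if "y \<in> S" for y
  proof -
    have "(\<Sum>b\<in>parseval_frame. (z y \<bullet> b) *\<^sub>R (T y b - T x b)) = T y (z y) - T x (z y)"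
      unfolding linear_parseval_frame_expand[OF lin[OF that], of "z y"] linear_parseval_frame_expand[OF lin[OF S(2)], of "z y"]
      by (simp add: sum_subtractf scaleR_diff_right)
    then show ?thesis using z[OF that] L(2) by simp
  qed
  have dT: "((\<lambda>y. T y b - T x b) has_derivative T' b) (at x)" for b
    using has_derivative_diff[OF T has_derivative_const[of "T x b"]] by simp
  have "((\<lambda>y. (z y \<bullet> b) *\<^sub>R (T y b - T x b)) has_derivative (\<lambda>v. (z x \<bullet> b) *\<^sub>R T' b v)) (at x)" for b
    by (rule has_derivative_scaleR_null[OF _ dT]) (auto intro: continuous_intros zc)
  then have "(?w has_derivative (\<lambda>v. L (r' v - (\<Sum>b\<in>parseval_frame. (z x \<bullet> b) *\<^sub>R T' b v)))) (at x)"
    by (intro bounded_linear.has_derivative[OF L(1)] has_derivative_diff r has_derivative_sum)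
  from has_derivative_transform_within_open[OF this S eq] that L(3) show ?thesis by blast
qed

text \<open>
  This replaces Cramer's rule. The directional derivatives of \<open>z\<close> solve a system with the same
  operators \<open>T\<close>, whose right-hand side involves \<open>z\<close> itself but only first derivatives of \<open>T\<close> and \<open>r\<close>;
  so each order of differentiability of \<open>z\<close> yields the next one.
\<close>

lemma C_diff_on_solution:
  fixes T :: "'e::real_normed_vector \<Rightarrow> 'f::{real_inner, heine_borel} \<Rightarrow> 'f"
  assumes S: "open S" and lin: "\<And>x. x \<in> S \<Longrightarrow> linear (T x)" and inj: "\<And>x. x \<in> S \<Longrightarrow> inj (T x)"
    and "\<And>v. C_diff_on k S (\<lambda>x. T x v)" "C_diff_on k S r"
    and "\<And>x. x \<in> S \<Longrightarrow> T x (z x) = r x"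
  shows "C_diff_on k S z"
  using assms(4-)
proof (induction k arbitrary: r z)
  case 0
  have "continuous_on S (\<lambda>x. T x v)" "continuous_on S r" for v using 0 by simp_all
  then have "isCont z x" if "x \<in> S" for x
    using solution_continuous[where T=T and r=r and z=z, OF S that lin inj] 0(3) by blast
  then show ?case by (simp add: continuous_at_imp_continuous_on)
next
  case (Suc k)
  note T = C_diff_on_SucD[OF Suc.prems(1)] and r = C_diff_on_SucD[OF Suc.prems(2)]
  note T0 = Suc.prems(1)[THEN C_diff_on_Suc_imp] and r0 = Suc.prems(2)[THEN C_diff_on_Suc_imp]
  have zk: "C_diff_on k S z" by (rule Suc.IH[OF T0 r0 Suc.prems(3)])
  have "continuous_on S (\<lambda>x. T x v)" "continuous_on S r" for v
    using T(1)[THEN has_derivative_continuous] r(1)[THEN has_derivative_continuous]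
    by (auto intro!: continuous_at_imp_continuous_on)
  then have zc: "isCont z x" if "x \<in> S" for x
    using solution_continuous[where T=T and r=r and z=z, OF S that lin inj] Suc.prems(3) by blast
  define R where "R v x = frechet_derivative r (at x) v
    - (\<Sum>b\<in>parseval_frame. (z x \<bullet> b) *\<^sub>R frechet_derivative (\<lambda>y. T y b) (at x) v)" for v x
  have "\<forall>x\<in>S. \<exists>z'. (z has_derivative z') (at x) \<and> (\<forall>v. T x (z' v) = R v x)"
  proof
    fix x assume x: "x \<in> S"
    obtain z' where "(z has_derivative z') (at x)"
      "\<And>v. T x (z' v) = frechet_derivative r (at x) v
        - (\<Sum>b\<in>parseval_frame. (z x \<bullet> b) *\<^sub>R frechet_derivative (\<lambda>y. T y b) (at x) v)"
      by (rule solution_derivative[where T=T, OF S x lin inj zc[OF x] T(1)[OF x] r(1)[OF x] Suc.prems(3)])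
        (assumption | rule that)+
    then show "\<exists>z'. (z has_derivative z') (at x) \<and> (\<forall>v. T x (z' v) = R v x)"
      unfolding R_def by blast
  qed
  then obtain z' where z': "\<And>x. x \<in> S \<Longrightarrow> (z has_derivative z' x) (at x)"
    "\<And>x v. x \<in> S \<Longrightarrow> T x (z' x v) = R v x" unfolding bchoice_iff by blast
  have Rk: "C_diff_on k S (R v)" for v
    unfolding R_def
    by (intro C_diff_on_minus C_diff_on_sum C_diff_on_scaleR S r(2) T(2)
        C_diff_on_linear[OF S bounded_linear_inner_left zk])
  show ?case
  proof (rule C_diff_on_SucI[OF S z'(1)])
    show "C_diff_on k S (\<lambda>x. z' x v)" for v
      by (rule Suc.IH[where r = "R v", OF T0 Rk]) (rule z'(2))
  qed
qed

section \<open>Smooth functions on a manifold\<close>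

locale manifold =
  fixes M :: "('m::{t2_space, second_countable_topology}, 'e::{real_inner, heine_borel}) atlas"
  assumes manifold: "smooth_manifold M"
begin

lemma chart_open: "(U, \<phi>) \<in> M \<Longrightarrow> open U"
  and chart_homeomorphism: "(U, \<phi>) \<in> M \<Longrightarrow> homeomorphism U (\<phi> ` U) \<phi> (inv_into U \<phi>)"
  using manifold unfolding smooth_manifold_def by auto

lemma chart_inverse: "(U, \<phi>) \<in> M \<Longrightarrow> x \<in> U \<Longrightarrow> inv_into U \<phi> (\<phi> x) = x"
  using chart_homeomorphism unfolding homeomorphism_def by blast

lemma chart_exists: "\<exists>U \<phi>. (U, \<phi>) \<in> M \<and> x \<in> U"
  using manifold unfolding smooth_manifold_def by blast

lemma open_chart_image:
  assumes "(U, \<phi>) \<in> M" "open W"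
  shows "open (\<phi> ` (U \<inter> W))"
proof -
  have "openin (top_of_set (\<phi> ` U)) (\<phi> ` (U \<inter> W))"
    using homeomorphism_imp_open_map[OF chart_homeomorphism[OF assms(1)]] assms(2)
    by (simp add: openin_open_Int)
  moreover have "open (\<phi> ` U)" using manifold assms(1) unfolding smooth_manifold_def by auto
  ultimately show ?thesis using openin_open_trans by blast
qed

lemma open_chart_preimage:
  assumes "(U, \<phi>) \<in> M" "open T" "T \<subseteq> \<phi> ` U"
  shows "open (inv_into U \<phi> ` T)"
proof -
  have "openin (top_of_set U) (inv_into U \<phi> ` T)"
    using homeomorphism_imp_open_map[OF homeomorphism_symD[OF chart_homeomorphism[OF assms(1)]]] assms(2,3)
    by (metis open_openin openin_subtopology_Int2 inf.absorb_iff2 openin_open_Int)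
  then show ?thesis using chart_open[OF assms(1)] openin_open_trans by blast
qed

lemma smooth_fun_onI:
  assumes "\<And>U \<phi> k. (U, \<phi>) \<in> M \<Longrightarrow> C_diff_on k (\<phi> ` (U \<inter> W)) (\<lambda>y. h (inv_into U \<phi> y))"
  shows "smooth_fun_on M W h"
  using assms unfolding smooth_fun_on_def smooth_on_def o_def by blast

lemma smooth_fun_onD:
  assumes "smooth_fun_on M W h" "(U, \<phi>) \<in> M"
  shows "C_diff_on k (\<phi> ` (U \<inter> W)) (\<lambda>y. h (inv_into U \<phi> y))"
  using assms unfolding smooth_fun_on_def smooth_on_def o_def by blast

lemma smooth_fun_on_local:
  assumes "\<And>x. x \<in> W \<Longrightarrow> \<exists>N. open N \<and> x \<in> N \<and> smooth_fun_on M N h"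
  shows "smooth_fun_on M W h"
proof (rule smooth_fun_onI, rule C_diff_on_local)
  fix U \<phi> k y assume c: "(U, \<phi>) \<in> M" and "y \<in> \<phi> ` (U \<inter> W)"
  then obtain x where x: "x \<in> U" "x \<in> W" "y = \<phi> x" by blast
  then obtain N where N: "open N" "x \<in> N" "smooth_fun_on M N h" using assms by blast
  then show "\<exists>T. open T \<and> y \<in> T \<and> C_diff_on k T (\<lambda>y. h (inv_into U \<phi> y))"
    using open_chart_image[OF c N(1)] smooth_fun_onD[OF N(3) c] x by blast
qed

lemma smooth_fun_on_mono: "smooth_fun_on M W h \<Longrightarrow> V \<subseteq> W \<Longrightarrow> smooth_fun_on M V h"
  by (rule smooth_fun_onI, erule C_diff_on_mono[OF smooth_fun_onD]) auto

lemma smooth_fun_on_cong: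
  assumes "open W" "\<And>x. x \<in> W \<Longrightarrow> f x = h x" "smooth_fun_on M W f"
  shows "smooth_fun_on M W h"
proof (rule smooth_fun_onI)
  fix U \<phi> k assume c: "(U, \<phi>) \<in> M"
  show "C_diff_on k (\<phi> ` (U \<inter> W)) (\<lambda>y. h (inv_into U \<phi> y))"
    by (rule C_diff_on_cong[OF open_chart_image[OF c assms(1)] _ smooth_fun_onD[OF assms(3) c]])
      (auto simp: chart_inverse[OF c] assms(2))
qed

text \<open>
  Smoothness in a single chart suffices, because the transition maps are smooth.
\<close>

lemma smooth_fun_on_chart:
  assumes c: "(U, \<phi>) \<in> M" and W: "open W" "W \<subseteq> U"
    and h: "\<And>k. C_diff_on k (\<phi> ` W) (\<lambda>y. h (inv_into U \<phi> y))"
  shows "smooth_fun_on M W h"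
proof (rule smooth_fun_onI)
  fix V \<psi> k assume d: "(V, \<psi>) \<in> M"
  let ?t = "\<lambda>y. \<phi> (inv_into V \<psi> y)"
  note o = open_chart_image[OF d W(1)]
  have "smooth_on (\<psi> ` (V \<inter> U)) (\<phi> \<circ> inv_into V \<psi>)"
    using manifold c d unfolding smooth_manifold_def by blast
  then have t: "C_diff_on k (\<psi> ` (V \<inter> W)) ?t"
    unfolding smooth_on_def o_def using W(2) by (meson C_diff_on_mono Int_mono image_mono order_refl)
  have "open (\<phi> ` W)" using open_chart_image[OF c W(1)] W(2) by (simp add: Int_absorb1)
  have "?t ` \<psi> ` (V \<inter> W) \<subseteq> \<phi> ` W" by (auto simp: chart_inverse[OF d])
  from C_diff_on_compose[OF o \<open>open (\<phi> ` W)\<close> this t h]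
  have "C_diff_on k (\<psi> ` (V \<inter> W)) (\<lambda>y. h (inv_into U \<phi> (?t y)))" .
  then show "C_diff_on k (\<psi> ` (V \<inter> W)) (\<lambda>y. h (inv_into V \<psi> y))"
    by (rule C_diff_on_cong[OF o, rotated]) (use W(2) in \<open>auto simp: chart_inverse[OF d] chart_inverse[OF c]\<close>)
qed

lemma smooth_fun_on_const: "smooth_fun_on M W (\<lambda>x. c)"
  by (rule smooth_fun_onI) simp

lemma smooth_fun_on_linear:
  "open W \<Longrightarrow> bounded_linear l \<Longrightarrow> smooth_fun_on M W h \<Longrightarrow> smooth_fun_on M W (\<lambda>x. l (h x))"
  by (rule smooth_fun_onI, rule C_diff_on_linear[OF open_chart_image _ smooth_fun_onD])

lemma smooth_fun_on_add:
  "open W \<Longrightarrow> smooth_fun_on M W f \<Longrightarrow> smooth_fun_on M W h \<Longrightarrow> smooth_fun_on M W (\<lambda>x. f x + h x)"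
  by (rule smooth_fun_onI) (intro C_diff_on_add open_chart_image smooth_fun_onD)

lemma smooth_fun_on_diff:
  "open W \<Longrightarrow> smooth_fun_on M W f \<Longrightarrow> smooth_fun_on M W h \<Longrightarrow> smooth_fun_on M W (\<lambda>x. f x - h x)"
  by (rule smooth_fun_onI) (intro C_diff_on_minus open_chart_image smooth_fun_onD)

lemma smooth_fun_on_sum:
  "open W \<Longrightarrow> (\<And>i. i \<in> I \<Longrightarrow> smooth_fun_on M W (f i)) \<Longrightarrow> smooth_fun_on M W (\<lambda>x. \<Sum>i\<in>I. f i x)"
  by (rule smooth_fun_onI) (intro C_diff_on_sum open_chart_image smooth_fun_onD)

lemma smooth_fun_on_scaleR:
  "open W \<Longrightarrow> smooth_fun_on M W f \<Longrightarrow> smooth_fun_on M W h \<Longrightarrow> smooth_fun_on M W (\<lambda>x. f x *\<^sub>R h x)"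
  by (rule smooth_fun_onI) (intro C_diff_on_scaleR open_chart_image smooth_fun_onD)

lemma smooth_fun_on_mult:
  "open W \<Longrightarrow> smooth_fun_on M W f \<Longrightarrow> smooth_fun_on M W h \<Longrightarrow> smooth_fun_on M W (\<lambda>x. f x * h x :: real)"
  using smooth_fun_on_scaleR[of W f h] by simp

lemma smooth_fun_on_apply:
  fixes T :: "'m \<Rightarrow> 'f::{real_inner, heine_borel} \<Rightarrow> 'h::real_normed_vector"
  assumes "open W" "\<And>x. x \<in> W \<Longrightarrow> linear (T x)" "\<And>v. smooth_fun_on M W (\<lambda>x. T x v)"
    and "smooth_fun_on M W u"
  shows "smooth_fun_on M W (\<lambda>x. T x (u x))"
proof (rule smooth_fun_onI)
  fix U \<phi> k assume c: "(U, \<phi>) \<in> M"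
  show "C_diff_on k (\<phi> ` (U \<inter> W)) (\<lambda>y. T (inv_into U \<phi> y) (u (inv_into U \<phi> y)))"
    by (rule C_diff_on_apply[OF open_chart_image[OF c assms(1)]])
      (auto simp: chart_inverse[OF c] assms(2) intro: smooth_fun_onD[OF assms(3) c] smooth_fun_onD[OF assms(4) c])
qed

lemma smooth_fun_on_solution:
  fixes T :: "'m \<Rightarrow> 'f::{real_inner, heine_borel} \<Rightarrow> 'f"
  assumes "open W" "\<And>x. x \<in> W \<Longrightarrow> linear (T x)" "\<And>x. x \<in> W \<Longrightarrow> inj (T x)"
    and "\<And>v. smooth_fun_on M W (\<lambda>x. T x v)" "smooth_fun_on M W r"
    and "\<And>x. x \<in> W \<Longrightarrow> T x (z x) = r x"
  shows "smooth_fun_on M W z"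
proof (rule smooth_fun_onI)
  fix U \<phi> k assume c: "(U, \<phi>) \<in> M"
  show "C_diff_on k (\<phi> ` (U \<inter> W)) (\<lambda>y. z (inv_into U \<phi> y))"
    by (rule C_diff_on_solution[where T = "\<lambda>y. T (inv_into U \<phi> y)",
          OF open_chart_image[OF c assms(1)] _ _ smooth_fun_onD[OF assms(4) c] smooth_fun_onD[OF assms(5) c]])
      (auto simp: chart_inverse[OF c] assms(2,3,6))
qed

text \<open>
  The closed set \<open>K\<close> contains the support of \<open>h\<close> and separates it from the points outside \<open>W\<close>, where
  nothing is known about \<open>h\<close> except that it vanishes.
\<close>

lemma smooth_fun_on_zero_extension:
  assumes "open V" "open W" "closed K" "K \<subseteq> W" "smooth_fun_on M (V \<inter> W) h"
    and "\<And>x. x \<in> V \<Longrightarrow> x \<notin> K \<Longrightarrow> h x = 0"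
  shows "smooth_fun_on M V h"
proof (rule smooth_fun_on_local)
  fix x assume x: "x \<in> V"
  show "\<exists>N. open N \<and> x \<in> N \<and> smooth_fun_on M N h"
  proof (cases "x \<in> K")
    case True then show ?thesis using assms x by (intro exI[of _ "V \<inter> W"]) auto
  next
    case False
    have "smooth_fun_on M (V - K) h"
      by (rule smooth_fun_on_cong[OF _ _ smooth_fun_on_const[of _ 0]]) (use assms in auto)
    then show ?thesis using assms x False by (intro exI[of _ "V - K"]) auto
  qed
qed

text \<open>
  Transport a bump function on a ball of the model space. The closed ball is compact, hence so is its
  preimage \<open>K\<close>, and \<open>K\<close> is closed in \<open>M\<close> because \<open>M\<close> is Hausdorff. It suffices that \<open>\<beta>\<close> is nonzero
  near \<open>p\<close>: it is only used as a factor that can be cancelled there.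
\<close>

lemma manifold_bump:
  assumes "open W" "p \<in> W"
  obtains \<beta> K N where "\<beta> \<in> C_infinity M" "closed K" "K \<subseteq> W" "\<And>x. x \<notin> K \<Longrightarrow> \<beta> x = 0"
    "open N" "p \<in> N" "N \<subseteq> W" "\<And>x. x \<in> N \<Longrightarrow> \<beta> x \<noteq> 0"
proof -
  obtain U \<phi> where c: "(U, \<phi>) \<in> M" "p \<in> U" using chart_exists by blast
  obtain r where r: "r > 0" "cball (\<phi> p) r \<subseteq> \<phi> ` (U \<inter> W)"
    using open_contains_cball open_chart_image[OF c(1) assms(1)] c(2) assms(2) by blast
  obtain b :: "'e \<Rightarrow> real" where b: "smooth_on UNIV b" "\<And>y. y \<in> ball (\<phi> p) r \<Longrightarrow> b y \<noteq> 0"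
    "\<And>y. y \<notin> ball (\<phi> p) r \<Longrightarrow> b y = 0"
    using bump_exists[OF r(1)] by blast
  define \<beta> where "\<beta> x = (if x \<in> U then b (\<phi> x) else 0)" for x
  define K where "K = inv_into U \<phi> ` cball (\<phi> p) r"
  define N where "N = inv_into U \<phi> ` ball (\<phi> p) r"
  have sub: "cball (\<phi> p) r \<subseteq> \<phi> ` U" "ball (\<phi> p) r \<subseteq> \<phi> ` U" using r(2) ball_subset_cball by blast+
  have KW: "K \<subseteq> U \<inter> W"
  proof
    fix x assume "x \<in> K"
    then obtain y where "y \<in> cball (\<phi> p) r" "x = inv_into U \<phi> y" unfolding K_def by blast
    moreover then obtain q where "q \<in> U \<inter> W" "y = \<phi> q" using r(2) by blast
    ultimately show "x \<in> U \<inter> W" using chart_inverse[OF c(1)] by simp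
  qed
  have NK: "N \<subseteq> K" unfolding N_def K_def using ball_subset_cball by blast
  have "continuous_on (cball (\<phi> p) r) (inv_into U \<phi>)"
    using continuous_on_subset[OF homeomorphism_cont2[OF chart_homeomorphism[OF c(1)]] sub(1)] .
  then have "compact K" unfolding K_def by (intro compact_continuous_image compact_cball)
  then have K: "closed K" by (rule compact_imp_closed)
  have 0: "\<beta> x = 0" if "x \<notin> K" for x
  proof (cases "x \<in> U")
    case True
    have "x \<in> K" if "\<phi> x \<in> cball (\<phi> p) r"
      unfolding K_def using imageI[OF that, of "inv_into U \<phi>"] chart_inverse[OF c(1) True] by simp
    then have "\<phi> x \<notin> ball (\<phi> p) r" using \<open>x \<notin> K\<close> ball_subset_cball by blast
    then show ?thesis using b(3) \<beta>_def by simp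
  qed (simp add: \<beta>_def)
  have nz: "\<beta> x \<noteq> 0" if "x \<in> N" for x
  proof -
    have "x \<in> U" using \<open>x \<in> N\<close> NK KW by blast
    moreover obtain y where y: "y \<in> ball (\<phi> p) r" "x = inv_into U \<phi> y" using \<open>x \<in> N\<close> N_def by blast
    then have "\<phi> x = y" using sub(2) f_inv_into_f by (metis subsetD)
    ultimately show ?thesis using y(1) b(2) \<beta>_def by simp
  qed
  have "smooth_fun_on M U \<beta>"
  proof (rule smooth_fun_on_chart[OF c(1) chart_open[OF c(1)] order_refl])
    fix k
    have o: "open (\<phi> ` U)" using open_chart_image[OF c(1) open_UNIV] by simp
    show "C_diff_on k (\<phi> ` U) (\<lambda>y. \<beta> (inv_into U \<phi> y))"
      by (rule C_diff_on_cong[OF o, of b])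
        (use b(1) in \<open>auto simp: \<beta>_def chart_inverse[OF c(1)] smooth_on_def intro: C_diff_on_mono\<close>)
  qed
  then have "smooth_fun_on M UNIV \<beta>"
    using smooth_fun_on_zero_extension[OF open_UNIV chart_open[OF c(1)] K, of \<beta>] KW 0 by simp
  then have "\<beta> \<in> C_infinity M" by (simp add: C_infinity_def)
  moreover have "open N" unfolding N_def using open_chart_preimage[OF c(1) _ sub(2)] by simp
  moreover have "p \<in> N" unfolding N_def using chart_inverse[OF c] r(1) by (metis centre_in_ball image_eqI)
  ultimately show ?thesis using that K KW 0 NK nz by blast
qed

lemma C_infinity_D: "f \<in> C_infinity M \<Longrightarrow> smooth_fun_on M W f"
  unfolding C_infinity_def using smooth_fun_on_mono by blast

lemma C_infinity_const: "(\<lambda>x. c) \<in> C_infinity M"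
  and C_infinity_add: "f \<in> C_infinity M \<Longrightarrow> h \<in> C_infinity M \<Longrightarrow> (\<lambda>x. f x + h x) \<in> C_infinity M"
  and C_infinity_diff: "f \<in> C_infinity M \<Longrightarrow> h \<in> C_infinity M \<Longrightarrow> (\<lambda>x. f x - h x) \<in> C_infinity M"
  and C_infinity_mult: "f \<in> C_infinity M \<Longrightarrow> h \<in> C_infinity M \<Longrightarrow> (\<lambda>x. f x * h x) \<in> C_infinity M"
  by (simp_all add: C_infinity_def smooth_fun_on_const smooth_fun_on_add smooth_fun_on_diff smooth_fun_on_mult)

section \<open>Tangent vectors\<close>

lemma C_infinity_has_derivative:
  assumes "f \<in> C_infinity M" "(U, \<phi>) \<in> M" "x \<in> U"
  shows "((f \<circ> inv_into U \<phi>) has_derivative frechet_derivative (f \<circ> inv_into U \<phi>) (at (\<phi> x))) (at (\<phi> x))"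
proof -
  have "C_diff_on (Suc 0) (\<phi> ` (U \<inter> UNIV)) (f \<circ> inv_into U \<phi>)"
    unfolding o_def by (rule smooth_fun_onD[OF C_infinity_D[OF assms(1)] assms(2)])
  then show ?thesis by (rule C_diff_on_SucD(1)) (use assms in auto)
qed

lemma coord_vector_linear:
  assumes "(U, \<phi>) \<in> M" "x \<in> U"
  shows "linear (\<lambda>w. coord_vector M U \<phi> x w f)"
proof (cases "f \<in> C_infinity M")
  case True
  then show ?thesis
    using has_derivative_linear[OF C_infinity_has_derivative[OF True assms]] by (simp add: coord_vector_def)
qed (simp add: coord_vector_def linear_zero)

lemma coord_vector_add:
  assumes c: "(U, \<phi>) \<in> M" "x \<in> U" and f: "f \<in> C_infinity M" and h: "h \<in> C_infinity M"
  shows "coord_vector M U \<phi> x w (\<lambda>x. f x + h x) = coord_vector M U \<phi> x w f + coord_vector M U \<phi> x w h"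
proof -
  note d = has_derivative_add[OF C_infinity_has_derivative[OF f c] C_infinity_has_derivative[OF h c]]
  from frechet_derivative_at[OF d] show ?thesis
    using f h C_infinity_add[OF f h] by (auto simp: coord_vector_def o_def fun_eq_iff)
qed

lemma coord_vector_mult:
  assumes c: "(U, \<phi>) \<in> M" "x \<in> U" and f: "f \<in> C_infinity M" and h: "h \<in> C_infinity M"
  shows "coord_vector M U \<phi> x w (\<lambda>x. f x * h x)
    = f x * coord_vector M U \<phi> x w h + coord_vector M U \<phi> x w f * h x"
proof -
  note d = has_derivative_mult[OF C_infinity_has_derivative[OF f c] C_infinity_has_derivative[OF h c]]
  from frechet_derivative_at[OF d] show ?thesis
    using f h C_infinity_mult[OF f h] by (auto simp: coord_vector_def o_def fun_eq_iff chart_inverse[OF c])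
qed

text \<open>
  By the chain rule the coordinates are transformed by the derivative of the transition map, which
  does not depend on the function that the tangent vector acts on.
\<close>

lemma coord_vector_change_chart:
  assumes c: "(U, \<phi>) \<in> M" "x \<in> U" and d: "(V, \<psi>) \<in> M" "x \<in> V"
  shows "\<exists>v. coord_vector M U \<phi> x w = coord_vector M V \<psi> x v"
proof -
  let ?t = "\<psi> \<circ> inv_into U \<phi>"
  have "smooth_on (\<phi> ` (U \<inter> V)) ?t"
    using manifold c(1) d(1) unfolding smooth_manifold_def by blast
  then have "C_diff_on (Suc 0) (\<phi> ` (U \<inter> V)) ?t" unfolding smooth_on_def by blast
  from C_diff_on_SucD(1)[OF this, of "\<phi> x"]
  have t: "(?t has_derivative frechet_derivative ?t (at (\<phi> x))) (at (\<phi> x))" using c d by blast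
  have tx: "?t (\<phi> x) = \<psi> x" by (simp add: chart_inverse[OF c])
  have "coord_vector M U \<phi> x w f = coord_vector M V \<psi> x (frechet_derivative ?t (at (\<phi> x)) w) f" for f
  proof (cases "f \<in> C_infinity M")
    case True
    let ?F = "f \<circ> inv_into V \<psi>"
    have "((?F \<circ> ?t) has_derivative
        (frechet_derivative ?F (at (\<psi> x)) \<circ> frechet_derivative ?t (at (\<phi> x)))) (at (\<phi> x))"
      using diff_chain_at[OF t] C_infinity_has_derivative[OF True d] tx by simp
    then have "((f \<circ> inv_into U \<phi>) has_derivative
        (frechet_derivative ?F (at (\<psi> x)) \<circ> frechet_derivative ?t (at (\<phi> x)))) (at (\<phi> x))"
      by (rule has_derivative_transform_within_open[OF _ open_chart_image[OF c(1) chart_open[OF d(1)]]])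
        (use c d in \<open>auto simp: chart_inverse[OF c(1)] chart_inverse[OF d(1)]\<close>)
    from frechet_derivative_at[OF this] show ?thesis using True by (auto simp: coord_vector_def fun_eq_iff)
  qed (simp add: coord_vector_def)
  then show ?thesis by blast
qed

lemma tangent_fibre_range:
  assumes "(V, \<psi>) \<in> M" "x \<in> V"
  shows "fibre (tangent_bundle M) x = range (coord_vector M V \<psi> x)"
proof
  show "fibre (tangent_bundle M) x \<subseteq> range (coord_vector M V \<psi> x)"
  proof
    fix t assume "t \<in> fibre (tangent_bundle M) x"
    then obtain U \<phi> w where "(U, \<phi>) \<in> M" "x \<in> U" "t = coord_vector M U \<phi> x w"
      by (auto simp: tangent_bundle_def)
    then show "t \<in> range (coord_vector M V \<psi> x)"
      using coord_vector_change_chart[of U \<phi> x V \<psi> w] assms by auto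
  qed
  show "range (coord_vector M V \<psi> x) \<subseteq> fibre (tangent_bundle M) x"
    using assms by (auto simp: tangent_bundle_def)
qed

end

lemma sum_fun_apply: "(\<Sum>i\<in>I. f i) x = (\<Sum>i\<in>I. f i x)"
  by (induction I rule: infinite_finite_induct) auto

locale metric_algebroid = manifold M
  for M :: "('m::{t2_space, second_countable_topology}, 'e::{real_inner, heine_borel}) atlas" +
  fixes A :: "('m, 'v::real_vector, 'f::{real_inner, heine_borel}) algebroid"
    and g :: "'m \<Rightarrow> 'v \<Rightarrow> 'v \<Rightarrow> real"
  assumes algebroid: "skew_algebroid M A"
    and metric: "pseudo_riemannian_metric M A g"
begin

section \<open>Sections\<close>

lemma vector_bundle: "vector_bundle M A"
  using algebroid unfolding skew_algebroid_def by blast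

lemma fibre_subspace: "subspace (fibre A x)"
  using vector_bundle unfolding vector_bundle_def by blast

lemmas fibre_add = subspace_add[OF fibre_subspace]
  and fibre_scale = subspace_scale[OF fibre_subspace]
  and fibre_zero = subspace_0[OF fibre_subspace]

lemma triv_exists: "\<exists>U \<sigma>. (U, \<sigma>) \<in> trivs A \<and> x \<in> U"
  using vector_bundle unfolding vector_bundle_def by blast

lemma triv_open: "(U, \<sigma>) \<in> trivs A \<Longrightarrow> open U"
  and triv_linear: "(U, \<sigma>) \<in> trivs A \<Longrightarrow> x \<in> U \<Longrightarrow> linear (\<sigma> x)"
  and triv_bij: "(U, \<sigma>) \<in> trivs A \<Longrightarrow> x \<in> U \<Longrightarrow> bij_betw (\<sigma> x) UNIV (fibre A x)"
  using vector_bundle unfolding vector_bundle_def by auto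

lemma triv_transition:
  "(U, \<sigma>) \<in> trivs A \<Longrightarrow> (V, \<tau>) \<in> trivs A \<Longrightarrow> smooth_fun_on M (U \<inter> V) (\<lambda>x. inv (\<tau> x) (\<sigma> x w))"
  using vector_bundle unfolding vector_bundle_def by blast

lemma triv_inv:
  assumes "(U, \<sigma>) \<in> trivs A" "x \<in> U"
  shows triv_fibre: "\<sigma> x w \<in> fibre A x"
    and triv_inv_left: "inv (\<sigma> x) (\<sigma> x w) = w"
    and triv_inv_right: "a \<in> fibre A x \<Longrightarrow> \<sigma> x (inv (\<sigma> x) a) = a"
proof -
  note b = triv_bij[OF assms]
  show "\<sigma> x w \<in> fibre A x" using b bij_betwE by blast
  show "inv (\<sigma> x) (\<sigma> x w) = w" using b by (simp add: bij_betw_def inv_f_f)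
  show "\<sigma> x (inv (\<sigma> x) a) = a" if "a \<in> fibre A x"
    using b that by (simp add: bij_betw_def f_inv_into_f)
qed

lemma triv_inv_add:
  assumes "(U, \<sigma>) \<in> trivs A" "x \<in> U" "a \<in> fibre A x" "b \<in> fibre A x"
  shows "inv (\<sigma> x) (a + b) = inv (\<sigma> x) a + inv (\<sigma> x) b"
  using triv_inv_left[OF assms(1,2), of "inv (\<sigma> x) a + inv (\<sigma> x) b"]
  by (simp add: linear_add[OF triv_linear[OF assms(1,2)]] triv_inv_right[OF assms(1,2)] assms(3,4))

lemma triv_inv_scale:
  assumes "(U, \<sigma>) \<in> trivs A" "x \<in> U" "a \<in> fibre A x"
  shows "inv (\<sigma> x) (c *\<^sub>R a) = c *\<^sub>R inv (\<sigma> x) a"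
  using triv_inv_left[OF assms(1,2), of "c *\<^sub>R inv (\<sigma> x) a"]
  by (simp add: linear_scale[OF triv_linear[OF assms(1,2)]] triv_inv_right[OF assms(1,2)] assms(3))

lemma section_fibre: "X \<in> sections M A \<Longrightarrow> X x \<in> fibre A x"
  and section_coords: "X \<in> sections M A \<Longrightarrow> (U, \<sigma>) \<in> trivs A \<Longrightarrow> smooth_fun_on M U (\<lambda>x. inv (\<sigma> x) (X x))"
  unfolding sections_def by auto

text \<open>
  It suffices to test smoothness near each point in one trivialisation, as the transition functions
  are smooth families of linear maps.
\<close>

lemma sectionI:
  assumes fib: "\<And>x. X x \<in> fibre A x"
    and loc: "\<And>p. \<exists>U \<sigma> N. (U, \<sigma>) \<in> trivs A \<and> open N \<and> p \<in> N \<and> N \<subseteq> U \<and> smooth_fun_on M N (\<lambda>x. inv (\<sigma> x) (X x))"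
  shows "X \<in> sections M A"
  unfolding sections_def
proof (safe)
  show "X x \<in> fibre A x" for x by (rule fib)
  fix V \<tau> assume V: "(V, \<tau>) \<in> trivs A"
  show "smooth_fun_on M V (\<lambda>x. inv (\<tau> x) (X x))"
  proof (rule smooth_fun_on_local)
    fix p assume p: "p \<in> V"
    obtain U \<sigma> N where U: "(U, \<sigma>) \<in> trivs A" and N: "open N" "p \<in> N" "N \<subseteq> U"
      and s: "smooth_fun_on M N (\<lambda>x. inv (\<sigma> x) (X x))" using loc by blast
    have o: "open (N \<inter> V)" using N(1) triv_open[OF V] by blast
    have "smooth_fun_on M (N \<inter> V) (\<lambda>x. inv (\<tau> x) (\<sigma> x (inv (\<sigma> x) (X x))))"
    proof (rule smooth_fun_on_apply[OF o, of "\<lambda>x w. inv (\<tau> x) (\<sigma> x w)"])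
      fix x assume x: "x \<in> N \<inter> V"
      then have "x \<in> U" "x \<in> V" using N by auto
      then show "linear (\<lambda>w. inv (\<tau> x) (\<sigma> x w))"
        by (intro linearI)
          (simp_all add: linear_add[OF triv_linear[OF U]] linear_scale[OF triv_linear[OF U]]
            triv_inv_add[OF V] triv_inv_scale[OF V] triv_fibre[OF U])
    next
      show "smooth_fun_on M (N \<inter> V) (\<lambda>x. inv (\<tau> x) (\<sigma> x w))" for w
        by (rule smooth_fun_on_mono[OF triv_transition[OF U V]]) (use N in auto)
      show "smooth_fun_on M (N \<inter> V) (\<lambda>x. inv (\<sigma> x) (X x))"
        by (rule smooth_fun_on_mono[OF s]) auto
    qed
    then have "smooth_fun_on M (N \<inter> V) (\<lambda>x. inv (\<tau> x) (X x))"
      by (rule smooth_fun_on_cong[OF o, rotated]) (use N in \<open>auto simp: triv_inv_right[OF U] fib subset_iff\<close>)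
    then show "\<exists>N. open N \<and> p \<in> N \<and> smooth_fun_on M N (\<lambda>x. inv (\<tau> x) (X x))" using o p N by blast
  qed
qed

lemma section_add:
  assumes X: "X \<in> sections M A" and Y: "Y \<in> sections M A"
  shows "X + Y \<in> sections M A"
  unfolding sections_def
proof (safe)
  show "(X + Y) x \<in> fibre A x" for x using section_fibre[OF X] section_fibre[OF Y] by (simp add: fibre_add)
  fix U \<sigma> assume U: "(U, \<sigma>) \<in> trivs A"
  show "smooth_fun_on M U (\<lambda>x. inv (\<sigma> x) ((X + Y) x))"
    by (rule smooth_fun_on_cong[OF triv_open[OF U] _ smooth_fun_on_add[OF triv_open[OF U] section_coords[OF X U] section_coords[OF Y U]]])
      (simp add: triv_inv_add[OF U] section_fibre X Y)
qed

lemma section_smult: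
  assumes f: "f \<in> C_infinity M" and X: "X \<in> sections M A"
  shows "f \<odot> X \<in> sections M A"
  unfolding sections_def
proof (safe)
  show "(f \<odot> X) x \<in> fibre A x" for x using section_fibre[OF X] by (simp add: fun_mult_def fibre_scale)
  fix U \<sigma> assume U: "(U, \<sigma>) \<in> trivs A"
  show "smooth_fun_on M U (\<lambda>x. inv (\<sigma> x) ((f \<odot> X) x))"
    by (rule smooth_fun_on_cong[OF triv_open[OF U] _ smooth_fun_on_scaleR[OF triv_open[OF U] C_infinity_D[OF f] section_coords[OF X U]]])
      (simp add: triv_inv_scale[OF U] section_fibre X fun_mult_def)
qed

lemma scaleR_eq_smult: "c *\<^sub>R X = (\<lambda>_. c) \<odot> X"
  by (simp add: fun_mult_def scaleR_fun_def)

lemma section_scaleR: "X \<in> sections M A \<Longrightarrow> c *\<^sub>R X \<in> sections M A"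
  unfolding scaleR_eq_smult by (intro section_smult C_infinity_const)

lemma section_uminus: "X \<in> sections M A \<Longrightarrow> - X \<in> sections M A"
  using section_scaleR[of X "-1"] by simp

lemma section_diff: "X \<in> sections M A \<Longrightarrow> Y \<in> sections M A \<Longrightarrow> X - Y \<in> sections M A"
  using section_add[of X "- Y"] section_uminus by simp

text \<open>
  A constant vector of the typical fibre gives a section over the domain of a trivialisation; a
  bump function extends it by zero.
\<close>

lemma section_cutoff:
  assumes U: "(U, \<sigma>) \<in> trivs A" and \<beta>: "\<beta> \<in> C_infinity M" and K: "closed K" "K \<subseteq> U"
    and 0: "\<And>x. x \<notin> K \<Longrightarrow> \<beta> x = 0"
  shows "(\<lambda>x. if x \<in> U then \<beta> x *\<^sub>R \<sigma> x w else 0) \<in> sections M A" (is "?X \<in> _")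
proof (rule sectionI)
  show "?X x \<in> fibre A x" for x using triv_fibre[OF U] fibre_scale fibre_zero by auto
  fix p
  show "\<exists>U \<sigma> N. (U, \<sigma>) \<in> trivs A \<and> open N \<and> p \<in> N \<and> N \<subseteq> U \<and> smooth_fun_on M N (\<lambda>x. inv (\<sigma> x) (?X x))"
  proof (cases "p \<in> U")
    case True
    have "smooth_fun_on M U (\<lambda>x. inv (\<sigma> x) (?X x))"
      by (rule smooth_fun_on_cong[OF triv_open[OF U] _ smooth_fun_on_scaleR[OF triv_open[OF U] C_infinity_D[OF \<beta>] smooth_fun_on_const[of _ w]]])
        (simp add: triv_inv_scale[OF U] triv_fibre[OF U] triv_inv_left[OF U])
    then show ?thesis using U True triv_open[OF U] by blast
  next
    case False
    obtain V \<tau> where V: "(V, \<tau>) \<in> trivs A" "p \<in> V" using triv_exists by blast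
    have o: "open (V - K)" using triv_open[OF V(1)] K by blast
    have "inv (\<tau> x) 0 = 0" if "x \<in> V" for x
      using triv_inv_left[OF V(1) that, of 0] linear_0[OF triv_linear[OF V(1) that]] by simp
    then have "smooth_fun_on M (V - K) (\<lambda>x. inv (\<tau> x) (?X x))"
      by (intro smooth_fun_on_cong[OF o _ smooth_fun_on_const[of _ 0]]) (auto simp: 0)
    moreover have "p \<in> V - K" using V False K by blast
    ultimately show ?thesis using V(1) o by blast
  qed
qed

lemma section_through:
  assumes "a \<in> fibre A p"
  obtains X where "X \<in> sections M A" "X p = a"
proof -
  obtain U \<sigma> where U: "(U, \<sigma>) \<in> trivs A" "p \<in> U" using triv_exists by blast
  obtain \<beta> K N where b: "\<beta> \<in> C_infinity M" "closed K" "K \<subseteq> U" "\<And>x. x \<notin> K \<Longrightarrow> \<beta> x = 0" "p \<in> N"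
    "\<And>x. x \<in> N \<Longrightarrow> \<beta> x \<noteq> 0"
    using manifold_bump[OF triv_open[OF U(1)] U(2)] by metis
  let ?X = "\<lambda>x. if x \<in> U then \<beta> x *\<^sub>R \<sigma> x ((1 / \<beta> p) *\<^sub>R inv (\<sigma> p) a) else 0"
  have "?X p = a"
    using b(5,6) U assms by (simp add: linear_scale[OF triv_linear[OF U]] triv_inv_right[OF U])
  with that section_cutoff[OF U(1) b(1-4)] show ?thesis by blast
qed

section \<open>The metric\<close>

lemma metric_bilinear: "bilinear_on_set (fibre A x) (g x)"
  and metric_sym: "a \<in> fibre A x \<Longrightarrow> b \<in> fibre A x \<Longrightarrow> g x a b = g x b a"
  and metric_nondegenerate: "a \<in> fibre A x \<Longrightarrow> (\<And>b. b \<in> fibre A x \<Longrightarrow> g x a b = 0) \<Longrightarrow> a = 0"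
  and metric_smooth: "(U, \<sigma>) \<in> trivs A \<Longrightarrow> smooth_fun_on M U (\<lambda>x. g x (\<sigma> x v) (\<sigma> x w))"
  using metric unfolding pseudo_riemannian_metric_def by auto

lemma metric_add_left: "a \<in> fibre A x \<Longrightarrow> b \<in> fibre A x \<Longrightarrow> c \<in> fibre A x \<Longrightarrow> g x (a + b) c = g x a c + g x b c"
  and metric_add_right: "a \<in> fibre A x \<Longrightarrow> b \<in> fibre A x \<Longrightarrow> c \<in> fibre A x \<Longrightarrow> g x c (a + b) = g x c a + g x c b"
  and metric_scale_left: "a \<in> fibre A x \<Longrightarrow> c \<in> fibre A x \<Longrightarrow> g x (r *\<^sub>R a) c = r * g x a c"
  and metric_scale_right: "a \<in> fibre A x \<Longrightarrow> c \<in> fibre A x \<Longrightarrow> g x c (r *\<^sub>R a) = r * g x c a"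
  using metric_bilinear[of x] unfolding bilinear_on_set_def linear_on_set_def by simp_all

lemma metric_triv_linear:
  assumes "(U, \<sigma>) \<in> trivs A" "x \<in> U" "a \<in> fibre A x"
  shows "linear (\<lambda>w. g x (\<sigma> x w) a)" "linear (\<lambda>w. g x a (\<sigma> x w))"
  using assms(3)
  by (auto intro!: linearI simp: linear_add[OF triv_linear[OF assms(1,2)]] linear_scale[OF triv_linear[OF assms(1,2)]]
      metric_add_left metric_add_right metric_scale_left metric_scale_right triv_fibre[OF assms(1,2)])

lemma metric_eval_smooth:
  assumes X: "X \<in> sections M A" and Y: "Y \<in> sections M A"
  shows "metric_eval g X Y \<in> C_infinity M"
  unfolding C_infinity_def
proof (rule CollectI, rule smooth_fun_on_local)
  fix p
  obtain U \<sigma> where U: "(U, \<sigma>) \<in> trivs A" "p \<in> U" using triv_exists by blast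
  note o = triv_open[OF U(1)]
  let ?X = "\<lambda>x. inv (\<sigma> x) (X x)" and ?Y = "\<lambda>x. inv (\<sigma> x) (Y x)"
  have "smooth_fun_on M U (\<lambda>x. g x (\<sigma> x v) (\<sigma> x (?Y x)))" for v
    by (rule smooth_fun_on_apply[OF o, of "\<lambda>x w. g x (\<sigma> x v) (\<sigma> x w)", OF _ metric_smooth[OF U(1)] section_coords[OF Y U(1)]])
      (intro metric_triv_linear[OF U(1)] triv_fibre[OF U(1)])
  then have "smooth_fun_on M U (\<lambda>x. g x (\<sigma> x (?X x)) (\<sigma> x (?Y x)))"
    by (rule smooth_fun_on_apply[OF o, of "\<lambda>x v. g x (\<sigma> x v) (\<sigma> x (?Y x))", OF _ _ section_coords[OF X U(1)], rotated])
      (intro metric_triv_linear[OF U(1)] triv_fibre[OF U(1)])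
  then have "smooth_fun_on M U (metric_eval g X Y)"
    by (rule smooth_fun_on_cong[OF o, rotated])
      (simp add: metric_eval_def triv_inv_right[OF U(1)] section_fibre X Y)
  then show "\<exists>N. open N \<and> p \<in> N \<and> smooth_fun_on M N (metric_eval g X Y)" using U o by blast
qed

text \<open>
  There is a section through every vector of every fibre, so this is nondegeneracy in each fibre.
\<close>

lemma section_eqI:
  assumes X: "X \<in> sections M A" and Y: "Y \<in> sections M A"
    and eq: "\<And>Z x. Z \<in> sections M A \<Longrightarrow> metric_eval g X Z x = metric_eval g Y Z x"
  shows "X = Y"
proof
  fix x
  note f = section_fibre[OF X, of x] section_fibre[OF Y, of x]
  have d: "X x - Y x \<in> fibre A x" using f fibre_subspace subspace_diff by blast
  have "g x (X x - Y x) b = 0" if b: "b \<in> fibre A x" for b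
  proof -
    obtain Z where Z: "Z \<in> sections M A" "Z x = b" using section_through[OF b] .
    have "g x (X x - Y x + Y x) b = g x (X x - Y x) b + g x (Y x) b"
      by (rule metric_add_left[OF d f(2) b])
    then show ?thesis using eq[OF Z(1), of x] Z(2) by (simp add: metric_eval_def)
  qed
  then have "X x - Y x = 0" by (rule metric_nondegenerate[OF d])
  then show "X x = Y x" by simp
qed

section \<open>Tensorial forms are metric duals of sections\<close>

lemma linear_functional_inner_sum:
  fixes l :: "'f \<Rightarrow> real"
  assumes "linear l"
  shows "(\<Sum>e\<in>parseval_frame. l e *\<^sub>R e) \<bullet> w = l w"
  using linear_parseval_frame_expand[OF assms, of w] unfolding inner_sum_left
  by (simp add: mult.commute inner_commute)

text \<open>
  The operator \<open>T\<close> represents the bilinear form \<open>c g\<close>, read in a trivialisation, with respect to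
  the inner product of the typical fibre. It is injective because \<open>g\<close> is nondegenerate, and it turns
  representability of a functional by \<open>g\<close> into a linear equation.
\<close>

lemma gram_operator:
  assumes U: "(U, \<sigma>) \<in> trivs A" "x \<in> U" and c: "c \<noteq> 0"
  defines "T \<equiv> \<lambda>v. \<Sum>e\<in>parseval_frame. (c * g x (\<sigma> x v) (\<sigma> x e)) *\<^sub>R e"
  shows "linear T" "inj T" "T v \<bullet> w = c * g x (\<sigma> x v) (\<sigma> x w)"
proof -
  have l1: "linear (\<lambda>v. c * g x (\<sigma> x v) (\<sigma> x w))" for w
    using linear_compose_scale_right[OF metric_triv_linear(1)[OF U triv_fibre[OF U]], of c w] by simp
  have l2: "linear (\<lambda>w. c * g x (\<sigma> x v) (\<sigma> x w))" for v
    using linear_compose_scale_right[OF metric_triv_linear(2)[OF U triv_fibre[OF U]], of c v] by simp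
  show lin: "linear T"
    unfolding T_def
    by (intro linear_compose_sum ballI linearI) (simp_all add: linear_add[OF l1] linear_scale[OF l1] scaleR_add_left)
  show T: "T v \<bullet> w = c * g x (\<sigma> x v) (\<sigma> x w)" for v w
    unfolding T_def by (rule linear_functional_inner_sum[OF l2])
  have "v = 0" if "T v = 0" for v
  proof -
    have "g x (\<sigma> x v) (\<sigma> x w) = 0" for w using T[of v w] that c by simp
    then have "g x (\<sigma> x v) b = 0" if "b \<in> fibre A x" for b using triv_inv_right[OF U that] by metis
    then have "\<sigma> x v = 0" using metric_nondegenerate triv_fibre[OF U] by blast
    then show ?thesis using triv_inv_left[OF U, of v] triv_inv_left[OF U, of 0] linear_0[OF triv_linear[OF U]] by simp
  qed
  then show "inj T" using lin linear_injective_0 by blast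
qed

lemma section_sum:
  "finite I \<Longrightarrow> (\<And>i. i \<in> I \<Longrightarrow> X i \<in> sections M A) \<Longrightarrow> (\<Sum>i\<in>I. X i) \<in> sections M A"
proof (induction I rule: finite_induct)
  case empty
  obtain X where "X \<in> sections M A" "X undefined = 0" using section_through[OF fibre_zero] .
  then show ?case using section_scaleR[of X 0] by (simp add: zero_fun_def)
qed (simp add: section_add)

context
  fixes \<omega> :: "('m \<Rightarrow> 'v) \<Rightarrow> 'm \<Rightarrow> real"
  assumes form_smooth: "\<And>X. X \<in> sections M A \<Longrightarrow> \<omega> X \<in> C_infinity M"
    and form_add: "\<And>X Y x. X \<in> sections M A \<Longrightarrow> Y \<in> sections M A \<Longrightarrow> \<omega> (X + Y) x = \<omega> X x + \<omega> Y x"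
    and form_smult: "\<And>f X x. f \<in> C_infinity M \<Longrightarrow> X \<in> sections M A \<Longrightarrow> \<omega> (f \<odot> X) x = f x * \<omega> X x"
begin

lemma form_sum:
  "finite I \<Longrightarrow> (\<And>i. i \<in> I \<Longrightarrow> X i \<in> sections M A) \<Longrightarrow> \<omega> (\<Sum>i\<in>I. X i) x = (\<Sum>i\<in>I. \<omega> (X i) x)"
proof (induction I rule: finite_induct)
  case empty
  have "(0::'m \<Rightarrow> 'v) \<in> sections M A" using section_sum[of "{}"] by simp
  then have "\<omega> 0 x = 0" using form_add[of 0 0 x] by simp
  then show ?case unfolding sum.empty .
qed (simp add: section_sum form_add)

text \<open>
  With a bump function \<open>\<beta>\<close> and the cut-off sections \<open>E\<^sub>e = \<beta> \<sigma>(e)\<close> one has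
  \<open>\<beta>\<^sup>2 X = \<Sum>\<^sub>e a\<^sub>e E\<^sub>e\<close> globally, where the smooth functions \<open>a\<^sub>e\<close> are \<open>\<beta>\<close> times the coordinates of \<open>X\<close>.
  Linearity over the smooth functions then gives \<open>\<beta>(p)\<^sup>2 \<omega>(X)(p) = \<Sum>\<^sub>e a\<^sub>e(p) \<omega>(E\<^sub>e)(p) = 0\<close>.
\<close>

lemma form_zero_at:
  assumes X: "X \<in> sections M A" and 0: "X p = 0"
  shows "\<omega> X p = 0"
proof -
  obtain U \<sigma> where U: "(U, \<sigma>) \<in> trivs A" "p \<in> U" using triv_exists by blast
  note o = triv_open[OF U(1)]
  obtain \<beta> K N where b: "\<beta> \<in> C_infinity M" "closed K" "K \<subseteq> U" "\<And>x. x \<notin> K \<Longrightarrow> \<beta> x = 0" "p \<in> N"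
    "\<And>x. x \<in> N \<Longrightarrow> \<beta> x \<noteq> 0"
    using manifold_bump[OF triv_open[OF U(1)] U(2)] by metis
  define E where "E e = (\<lambda>x. if x \<in> U then \<beta> x *\<^sub>R \<sigma> x e else 0)" for e
  define a where "a e = (\<lambda>x. if x \<in> U then \<beta> x * (inv (\<sigma> x) (X x) \<bullet> e) else 0)" for e
  have E: "E e \<in> sections M A" for e unfolding E_def by (rule section_cutoff[OF U(1) b(1-4)])
  have a: "a e \<in> C_infinity M" for e
  proof -
    have "smooth_fun_on M U (\<lambda>x. \<beta> x * (inv (\<sigma> x) (X x) \<bullet> e))"
      by (intro smooth_fun_on_mult o C_infinity_D b smooth_fun_on_linear[OF o bounded_linear_inner_left section_coords[OF X U(1)]])
    then have "smooth_fun_on M U (a e)"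
      by (rule smooth_fun_on_cong[OF o, rotated]) (simp add: a_def)
    then have "smooth_fun_on M UNIV (a e)"
      by (intro smooth_fun_on_zero_extension[OF open_UNIV o b(2,3)]) (auto simp: a_def b(4))
    then show ?thesis by (simp add: C_infinity_def)
  qed
  have "(\<lambda>x. \<beta> x * \<beta> x) \<odot> X = (\<Sum>e\<in>parseval_frame. a e \<odot> E e)"
  proof
    fix x
    show "((\<lambda>x. \<beta> x * \<beta> x) \<odot> X) x = (\<Sum>e\<in>parseval_frame. a e \<odot> E e) x"
    proof (cases "x \<in> U")
      case True
      have "X x = (\<Sum>e\<in>parseval_frame. (inv (\<sigma> x) (X x) \<bullet> e) *\<^sub>R \<sigma> x e)"
        using linear_parseval_frame_expand[OF triv_linear[OF U(1) True]] triv_inv_right[OF U(1) True section_fibre[OF X]] by metis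
      then have "(\<beta> x * \<beta> x) *\<^sub>R X x = (\<Sum>e\<in>parseval_frame. (\<beta> x * \<beta> x) *\<^sub>R (inv (\<sigma> x) (X x) \<bullet> e) *\<^sub>R \<sigma> x e)"
        by (metis scaleR_sum_right)
      then show ?thesis using True
        by (simp add: sum_fun_apply fun_mult_def a_def E_def mult.assoc mult.left_commute mult.commute)
    next
      case False
      then have "\<beta> x = 0" using b(3,4) by blast
      then show ?thesis using False by (simp add: sum_fun_apply fun_mult_def a_def E_def)
    qed
  qed
  then have "\<beta> p * \<beta> p * \<omega> X p = (\<Sum>e\<in>parseval_frame. \<omega> (a e \<odot> E e) p)"
    using form_smult[OF C_infinity_mult[OF b(1) b(1)] X, of p]
      form_sum[OF finite_parseval_frame, of "\<lambda>e. a e \<odot> E e" p] section_smult[OF a E] by simp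
  also have "\<dots> = (\<Sum>e\<in>parseval_frame. a e p * \<omega> (E e) p)" by (simp add: form_smult a E)
  also have "\<dots> = 0"
    using 0 U triv_inv_left[OF U, of 0] linear_0[OF triv_linear[OF U]] by (simp add: a_def)
  finally show ?thesis using b(5,6) by simp
qed

lemma form_eq_at:
  assumes "X \<in> sections M A" "Y \<in> sections M A" "X p = Y p"
  shows "\<omega> X p = \<omega> Y p"
proof -
  have "\<omega> (X - Y) p = 0" by (rule form_zero_at) (use assms in \<open>simp_all add: section_diff\<close>)
  moreover have "\<omega> (X - Y + Y) p = \<omega> (X - Y) p + \<omega> Y p" using assms by (intro form_add section_diff)
  ultimately show ?thesis by simp
qed

text \<open>
  By the previous lemma \<open>\<omega>\<close> induces a linear functional on the fibre over \<open>p\<close>. The Gram operator is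
  injective and hence surjective, as the typical fibre is finite-dimensional.
\<close>

lemma form_represented_at:
  "\<exists>z\<in>fibre A p. \<forall>X\<in>sections M A. g p z (X p) = \<omega> X p"
proof -
  obtain U \<sigma> where U: "(U, \<sigma>) \<in> trivs A" "p \<in> U" using triv_exists by blast
  have "\<exists>S. \<forall>w. S w \<in> sections M A \<and> S w p = \<sigma> p w"
    by (intro choice allI) (rule section_through[OF triv_fibre[OF U]], blast)
  then obtain S where S: "\<And>w. S w \<in> sections M A" "\<And>w. S w p = \<sigma> p w" by blast
  define l where "l w = \<omega> (S w) p" for w
  have lin: "linear l"
  proof (rule linearI)
    fix v w
    show "l (v + w) = l v + l w" unfolding l_def
      by (subst form_add[symmetric]) (auto intro!: form_eq_at section_add S(1) simp: S(2) linear_add[OF triv_linear[OF U]])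
  next
    fix c w
    have "\<omega> (S (c *\<^sub>R w)) p = \<omega> ((\<lambda>_. c) \<odot> S w) p"
      by (rule form_eq_at[OF S(1) section_smult[OF C_infinity_const S(1)]])
        (simp add: S(2) fun_mult_def linear_scale[OF triv_linear[OF U]])
    then show "l (c *\<^sub>R w) = c *\<^sub>R l w"
      unfolding l_def by (simp add: form_smult[OF C_infinity_const S(1)])
  qed
  define T where "T v = (\<Sum>e\<in>parseval_frame. (1 * g p (\<sigma> p v) (\<sigma> p e)) *\<^sub>R e)" for v
  note T = gram_operator[OF U, of 1, folded T_def]
  obtain v where v: "T v = (\<Sum>e\<in>parseval_frame. l e *\<^sub>R e)"
    using finite_dim_inj_imp_surj[OF T(1,2)] by (metis one_neq_zero surjD)
  have "g p (\<sigma> p v) (X p) = \<omega> X p" if X: "X \<in> sections M A" for X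
  proof -
    let ?w = "inv (\<sigma> p) (X p)"
    have w: "\<sigma> p ?w = X p" by (rule triv_inv_right[OF U section_fibre[OF X]])
    have "g p (\<sigma> p v) (\<sigma> p ?w) = l ?w"
      using T(3)[of v ?w] linear_functional_inner_sum[OF lin, of ?w] v by simp
    also have "\<dots> = \<omega> X p" unfolding l_def by (rule form_eq_at[OF S(1) X]) (simp add: S(2) w)
    finally show ?thesis by (simp add: w)
  qed
  then show ?thesis using triv_fibre[OF U] by blast
qed

text \<open>
  The vectors given at each point form a section: testing against cut-off sections shows that their
  coordinates near \<open>p\<close> solve a linear system whose operators and right-hand side are smooth.
\<close>

lemma form_represented:
  "\<exists>Z\<in>sections M A. \<forall>X\<in>sections M A. metric_eval g Z X = \<omega> X"
proof -
  have "\<exists>Z. \<forall>p. Z p \<in> fibre A p \<and> (\<forall>X\<in>sections M A. g p (Z p) (X p) = \<omega> X p)"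
    using form_represented_at by (intro choice) blast
  then obtain Z where Z: "\<And>p. Z p \<in> fibre A p" "\<And>p X. X \<in> sections M A \<Longrightarrow> g p (Z p) (X p) = \<omega> X p"
    by blast
  have "Z \<in> sections M A"
  proof (rule sectionI[OF Z(1)])
    fix p
    obtain U \<sigma> where U: "(U, \<sigma>) \<in> trivs A" "p \<in> U" using triv_exists by blast
    obtain \<beta> K N where b: "\<beta> \<in> C_infinity M" "closed K" "K \<subseteq> U" "\<And>x. x \<notin> K \<Longrightarrow> \<beta> x = 0"
      and N: "open N" "p \<in> N" "N \<subseteq> U" "\<And>x. x \<in> N \<Longrightarrow> \<beta> x \<noteq> 0"
      using manifold_bump[OF triv_open[OF U(1)] U(2)] by metis
    define E where "E e = (\<lambda>x. if x \<in> U then \<beta> x *\<^sub>R \<sigma> x e else 0)" for e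
    have E: "E e \<in> sections M A" for e unfolding E_def by (rule section_cutoff[OF U(1) b])
    \<comment> \<open>The factor \<open>\<beta> x\<close> comes from testing against \<open>E e\<close> and is nonzero on \<open>N\<close>.\<close>
    define T where "T x v = (\<Sum>e\<in>parseval_frame. (\<beta> x * g x (\<sigma> x v) (\<sigma> x e)) *\<^sub>R e)" for x v
    have "smooth_fun_on M N (\<lambda>x. inv (\<sigma> x) (Z x))"
    proof (rule smooth_fun_on_solution[OF N(1), of T])
      fix x assume x: "x \<in> N"
      then have xU: "x \<in> U" using N by blast
      show "linear (T x)" "inj (T x)" unfolding T_def using gram_operator[OF U(1) xU N(4)[OF x]] by auto
      show "T x (inv (\<sigma> x) (Z x)) = (\<Sum>e\<in>parseval_frame. \<omega> (E e) x *\<^sub>R e)"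
        unfolding T_def triv_inv_right[OF U(1) xU Z(1)]
        by (intro sum.cong refl arg_cong2[of _ _ _ _ scaleR])
          (use xU in \<open>simp_all only: Z(2)[OF E, symmetric]\<close>, simp add: E_def metric_scale_right Z(1) triv_fibre[OF U(1)])
    next
      show "smooth_fun_on M N (\<lambda>x. \<Sum>e\<in>parseval_frame. \<omega> (E e) x *\<^sub>R e)"
        by (intro smooth_fun_on_sum smooth_fun_on_scaleR N(1) smooth_fun_on_const C_infinity_D form_smooth E)
      show "smooth_fun_on M N (\<lambda>x. T x v)" for v
        unfolding T_def
        by (intro smooth_fun_on_sum smooth_fun_on_scaleR smooth_fun_on_mult N(1) smooth_fun_on_const
            C_infinity_D b(1) smooth_fun_on_mono[OF metric_smooth[OF U(1)] N(3)])
    qed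
    then show "\<exists>U \<sigma> N. (U, \<sigma>) \<in> trivs A \<and> open N \<and> p \<in> N \<and> N \<subseteq> U \<and> smooth_fun_on M N (\<lambda>x. inv (\<sigma> x) (Z x))"
      using U N by blast
  qed
  then show ?thesis using Z(2) by (intro bexI[of _ Z] ballI ext) (simp_all add: metric_eval_def)
qed

lemma sharp_form:
  shows "sharp M A g \<omega> \<in> sections M A"
    and "X \<in> sections M A \<Longrightarrow> metric_eval g (sharp M A g \<omega>) X = \<omega> X"
proof -
  have "\<exists>!Z. Z \<in> sections M A \<and> (\<forall>X\<in>sections M A. metric_eval g Z X = \<omega> X)"
    using form_represented by (auto intro: section_eqI)
  from theI'[OF this] show "sharp M A g \<omega> \<in> sections M A"
    and "X \<in> sections M A \<Longrightarrow> metric_eval g (sharp M A g \<omega>) X = \<omega> X"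
    unfolding sharp_def by blast+
qed

end

section \<open>The anchor\<close>

lemma anchor_hom: "bundle_hom M A (tangent_bundle M) (anchor A)"
  using algebroid unfolding skew_algebroid_def by blast

lemma anchor_tangent: "a \<in> fibre A x \<Longrightarrow> anchor A x a \<in> fibre (tangent_bundle M) x"
  and anchor_linear_on: "linear_on_set (fibre A x) (anchor A x)"
  using anchor_hom unfolding bundle_hom_def by auto

lemma anchor_add: "a \<in> fibre A x \<Longrightarrow> b \<in> fibre A x \<Longrightarrow> anchor A x (a + b) f = anchor A x a f + anchor A x b f"
  and anchor_scale: "a \<in> fibre A x \<Longrightarrow> anchor A x (c *\<^sub>R a) f = c * anchor A x a f"
  using anchor_linear_on[of x] unfolding linear_on_set_def by simp_all

lemma anchor_coord_vector:
  assumes "a \<in> fibre A x"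
  obtains U \<phi> w where "(U, \<phi>) \<in> M" "x \<in> U" "anchor A x a = coord_vector M U \<phi> x w"
  using anchor_tangent[OF assms] by (auto simp: tangent_bundle_def)

text \<open>
  The anchor takes values in tangent vectors, which are derivations of the smooth functions.
\<close>

lemma anchor_derivation:
  assumes a: "a \<in> fibre A x" and f: "f \<in> C_infinity M" and h: "h \<in> C_infinity M"
  shows anchor_add_fun: "anchor A x a (\<lambda>x. f x + h x) = anchor A x a f + anchor A x a h"
    and anchor_mult_fun: "anchor A x a (\<lambda>x. f x * h x) = f x * anchor A x a h + anchor A x a f * h x"
proof -
  obtain U \<phi> w where "(U, \<phi>) \<in> M" "x \<in> U" "anchor A x a = coord_vector M U \<phi> x w"
    by (rule anchor_coord_vector[OF a])
  then show "anchor A x a (\<lambda>x. f x + h x) = anchor A x a f + anchor A x a h"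
    "anchor A x a (\<lambda>x. f x * h x) = f x * anchor A x a h + anchor A x a f * h x"
    by (simp_all add: coord_vector_add coord_vector_mult f h)
qed

lemma anchor_const: "a \<in> fibre A x \<Longrightarrow> anchor A x a (\<lambda>_. c) = 0"
proof -
  assume "a \<in> fibre A x"
  then obtain U \<phi> w where "(U, \<phi>) \<in> M" "x \<in> U" "anchor A x a = coord_vector M U \<phi> x w"
    by (rule anchor_coord_vector)
  then show ?thesis by (simp add: coord_vector_def C_infinity_const o_def)
qed

text \<open>
  Over the common domain of a trivialisation and a chart, the coordinates of the anchor and the
  derivatives of \<open>f\<close> are smooth, and the values of \<open>\<rho>(X)(f)\<close> depend linearly on the coordinates of
  \<open>\<rho> \<circ> \<sigma>(w)\<close> and of \<open>X\<close> in turn.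
\<close>

lemma anchor_deriv_smooth:
  assumes X: "X \<in> sections M A" and f: "f \<in> C_infinity M"
  shows "anchor_deriv A X f \<in> C_infinity M"
  unfolding C_infinity_def
proof (rule CollectI, rule smooth_fun_on_local)
  fix p
  obtain U \<sigma> where U: "(U, \<sigma>) \<in> trivs A" "p \<in> U" using triv_exists by blast
  obtain V \<phi> where V: "(V, \<phi>) \<in> M" "p \<in> V" using chart_exists by blast
  let ?W = "U \<inter> V"
  have o: "open ?W" using triv_open[OF U(1)] chart_open[OF V(1)] by blast
  have on: "x \<in> U" "x \<in> V" if "x \<in> ?W" for x using that by auto
  define u where "u w x = inv (coord_vector M V \<phi> x) (anchor A x (\<sigma> x w))" for w x
  have u_smooth: "smooth_fun_on M ?W (u w)" for w
  proof -
    have "(V, coord_vector M V \<phi>) \<in> trivs (tangent_bundle M)" using V by (auto simp: tangent_bundle_def)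
    then show ?thesis using anchor_hom U(1) unfolding bundle_hom_def u_def by blast
  qed
  have u: "anchor A x (\<sigma> x w) = coord_vector M V \<phi> x (u w x)" if "x \<in> ?W" for x w
    using anchor_tangent[OF triv_fibre[OF U(1) on(1)[OF that]]] tangent_fibre_range[OF V(1) on(2)[OF that]]
    by (simp add: u_def f_inv_into_f)
  have c_smooth: "smooth_fun_on M ?W (\<lambda>x. coord_vector M V \<phi> x v f)" for v
  proof (rule smooth_fun_on_chart[OF V(1) o])
    fix k
    have "C_diff_on (Suc k) (\<phi> ` (V \<inter> ?W)) (\<lambda>y. f (inv_into V \<phi> y))"
      by (rule smooth_fun_onD[OF C_infinity_D[OF f] V(1)])
    then have c: "C_diff_on k (\<phi> ` (V \<inter> ?W)) (\<lambda>y. frechet_derivative (f \<circ> inv_into V \<phi>) (at y) v)"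
      unfolding o_def by (rule C_diff_on_SucD(2))
    have "C_diff_on k (\<phi> ` (V \<inter> ?W)) (\<lambda>y. coord_vector M V \<phi> (inv_into V \<phi> y) v f)"
      by (rule C_diff_on_cong[OF open_chart_image[OF V(1) o] _ c])
        (auto simp: coord_vector_def f chart_inverse[OF V(1)])
    moreover have "V \<inter> ?W = ?W" by blast
    ultimately show "C_diff_on k (\<phi> ` ?W) (\<lambda>y. coord_vector M V \<phi> (inv_into V \<phi> y) v f)" by simp
  qed auto
  have "smooth_fun_on M ?W (\<lambda>x. coord_vector M V \<phi> x (u w x) f)" for w
    by (rule smooth_fun_on_apply[OF o, of "\<lambda>x v. coord_vector M V \<phi> x v f", OF _ c_smooth u_smooth])
      (rule coord_vector_linear[OF V(1) on(2)])
  then have "smooth_fun_on M ?W (\<lambda>x. anchor A x (\<sigma> x w) f)" for w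
    by (rule smooth_fun_on_cong[OF o, rotated]) (simp add: u)
  note T_smooth = this
  have T_linear: "linear (\<lambda>w. anchor A x (\<sigma> x w) f)" if "x \<in> ?W" for x
    by (rule linearI)
      (simp_all add: anchor_add anchor_scale triv_fibre[OF U(1) on(1)[OF that]]
        linear_add[OF triv_linear[OF U(1) on(1)[OF that]]] linear_scale[OF triv_linear[OF U(1) on(1)[OF that]]])
  have "smooth_fun_on M ?W (\<lambda>x. inv (\<sigma> x) (X x))"
    by (rule smooth_fun_on_mono[OF section_coords[OF X U(1)]]) auto
  then have "smooth_fun_on M ?W (\<lambda>x. anchor A x (\<sigma> x (inv (\<sigma> x) (X x))) f)"
    by (rule smooth_fun_on_apply[where T = "\<lambda>x w. anchor A x (\<sigma> x w) f", OF o T_linear T_smooth, rotated])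
  then have "smooth_fun_on M ?W (anchor_deriv A X f)"
    by (rule smooth_fun_on_cong[OF o, rotated])
      (simp add: anchor_deriv_def triv_inv_right[OF U(1)] section_fibre X)
  then show "\<exists>N. open N \<and> p \<in> N \<and> smooth_fun_on M N (anchor_deriv A X f)" using o U V by blast
qed

section \<open>The Koszul form\<close>

abbreviation \<Gamma> where "\<Gamma> \<equiv> sections M A"

text \<open>
  The form whose metric dual is the symmetric product. Up to the bracket term \<open>g([X,Y],Z)\<close> it is
  the right-hand side of Koszul's formula for \<open>2 g(\<nabla>\<^sub>X Y, Z)\<close>.
\<close>

definition koszul :: "('m \<Rightarrow> 'v) \<Rightarrow> ('m \<Rightarrow> 'v) \<Rightarrow> ('m, 'v) form"
  where "koszul X Y = alt_lie A X (flat g Y) + alt_lie A Y (flat g X) - alt_diff A (metric_eval g X Y)"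

lemma koszul_apply:
  "koszul X Y Z x = anchor_deriv A X (metric_eval g Y Z) x + anchor_deriv A Y (metric_eval g X Z) x
    - anchor_deriv A Z (metric_eval g X Y) x
    - metric_eval g Y (bracket A X Z) x - metric_eval g X (bracket A Y Z) x"
  by (simp add: koszul_def alt_lie_def flat_def alt_diff_def)

lemma bracket_section [simp]: "X \<in> \<Gamma> \<Longrightarrow> Y \<in> \<Gamma> \<Longrightarrow> bracket A X Y \<in> \<Gamma>"
  and bracket_skew: "X \<in> \<Gamma> \<Longrightarrow> Y \<in> \<Gamma> \<Longrightarrow> bracket A X Y = - bracket A Y X"
  and bracket_smult_right: "X \<in> \<Gamma> \<Longrightarrow> Y \<in> \<Gamma> \<Longrightarrow> f \<in> C_infinity M \<Longrightarrow>
      bracket A X (f \<odot> Y) = f \<odot> bracket A X Y + anchor_deriv A X f \<odot> Y"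
  using algebroid unfolding skew_algebroid_def by (blast, metis, metis)

lemma bracket_add_left: "X \<in> \<Gamma> \<Longrightarrow> Y \<in> \<Gamma> \<Longrightarrow> Z \<in> \<Gamma> \<Longrightarrow> bracket A (X + Y) Z = bracket A X Z + bracket A Y Z"
  and bracket_add_right: "X \<in> \<Gamma> \<Longrightarrow> Y \<in> \<Gamma> \<Longrightarrow> Z \<in> \<Gamma> \<Longrightarrow> bracket A Z (X + Y) = bracket A Z X + bracket A Z Y"
  using algebroid unfolding skew_algebroid_def bilinear_on_set_def linear_on_set_def by blast+

lemma bracket_smult_left:
  assumes "X \<in> \<Gamma>" "Y \<in> \<Gamma>" "f \<in> C_infinity M"
  shows "bracket A (f \<odot> X) Y = f \<odot> bracket A X Y - anchor_deriv A Y f \<odot> X"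
  using bracket_skew[of "f \<odot> X" Y] bracket_skew[of X Y] bracket_smult_right[of Y X f] assms section_smult[of f X]
  by (simp add: fun_eq_iff fun_mult_def)

lemma metric_eval_commute: "X \<in> \<Gamma> \<Longrightarrow> Y \<in> \<Gamma> \<Longrightarrow> metric_eval g X Y = metric_eval g Y X"
  by (simp add: metric_eval_def fun_eq_iff metric_sym section_fibre)

lemma metric_eval_add_left: "X \<in> \<Gamma> \<Longrightarrow> Y \<in> \<Gamma> \<Longrightarrow> Z \<in> \<Gamma> \<Longrightarrow>
    metric_eval g (X + Y) Z = (\<lambda>x. metric_eval g X Z x + metric_eval g Y Z x)"
  and metric_eval_add_right: "X \<in> \<Gamma> \<Longrightarrow> Y \<in> \<Gamma> \<Longrightarrow> Z \<in> \<Gamma> \<Longrightarrow>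
    metric_eval g Z (X + Y) = (\<lambda>x. metric_eval g Z X x + metric_eval g Z Y x)"
  and metric_eval_smult_left: "X \<in> \<Gamma> \<Longrightarrow> Z \<in> \<Gamma> \<Longrightarrow>
    metric_eval g (f \<odot> X) Z = (\<lambda>x. f x * metric_eval g X Z x)"
  and metric_eval_smult_right: "X \<in> \<Gamma> \<Longrightarrow> Z \<in> \<Gamma> \<Longrightarrow>
    metric_eval g Z (f \<odot> X) = (\<lambda>x. f x * metric_eval g Z X x)"
  by (simp_all add: metric_eval_def fun_eq_iff fun_mult_def metric_add_left metric_add_right
      metric_scale_left metric_scale_right section_fibre)

lemma metric_eval_diff_right: "X \<in> \<Gamma> \<Longrightarrow> Y \<in> \<Gamma> \<Longrightarrow> Z \<in> \<Gamma> \<Longrightarrow>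
    metric_eval g Z (X - Y) = (\<lambda>x. metric_eval g Z X x - metric_eval g Z Y x)"
  using metric_eval_add_right[of "X - Y" Y Z] by (simp add: section_diff fun_eq_iff)

lemma anchor_deriv_add_section:
  "X \<in> \<Gamma> \<Longrightarrow> Y \<in> \<Gamma> \<Longrightarrow> anchor_deriv A (X + Y) f x = anchor_deriv A X f x + anchor_deriv A Y f x"
  and anchor_deriv_smult_section: "X \<in> \<Gamma> \<Longrightarrow> anchor_deriv A (h \<odot> X) f x = h x * anchor_deriv A X f x"
  by (simp_all add: anchor_deriv_def fun_mult_def anchor_add anchor_scale section_fibre)

lemma anchor_deriv_const: "X \<in> \<Gamma> \<Longrightarrow> anchor_deriv A X (\<lambda>_. c) = (\<lambda>_. 0)"
  by (simp add: anchor_deriv_def anchor_const section_fibre)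

lemma anchor_deriv_add: "X \<in> \<Gamma> \<Longrightarrow> f \<in> C_infinity M \<Longrightarrow> h \<in> C_infinity M \<Longrightarrow>
    anchor_deriv A X (\<lambda>x. f x + h x) x = anchor_deriv A X f x + anchor_deriv A X h x"
  and anchor_deriv_mult: "X \<in> \<Gamma> \<Longrightarrow> f \<in> C_infinity M \<Longrightarrow> h \<in> C_infinity M \<Longrightarrow>
    anchor_deriv A X (\<lambda>x. f x * h x) x = f x * anchor_deriv A X h x + anchor_deriv A X f x * h x"
  by (simp_all add: anchor_deriv_def anchor_add_fun anchor_mult_fun section_fibre)

lemmas section_simps = section_add section_smult section_diff section_scaleR metric_eval_smooth anchor_deriv_smooth

lemmas calculus_simps = section_simps metric_eval_add_left metric_eval_add_right metric_eval_smult_left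
  metric_eval_smult_right metric_eval_diff_right anchor_deriv_add_section anchor_deriv_smult_section
  anchor_deriv_add anchor_deriv_mult bracket_add_left bracket_add_right bracket_smult_left bracket_smult_right

lemma koszul_smooth:
  assumes "X \<in> \<Gamma>" "Y \<in> \<Gamma>" "Z \<in> \<Gamma>"
  shows "koszul X Y Z \<in> C_infinity M"
proof -
  have "(\<lambda>x. koszul X Y Z x) \<in> C_infinity M"
    unfolding koszul_apply
    by (intro C_infinity_diff C_infinity_add anchor_deriv_smooth metric_eval_smooth bracket_section assms)
  then show ?thesis .
qed

lemma koszul_add_form:
  "X \<in> \<Gamma> \<Longrightarrow> Y \<in> \<Gamma> \<Longrightarrow> Z \<in> \<Gamma> \<Longrightarrow> W \<in> \<Gamma> \<Longrightarrow> koszul X Y (Z + W) x = koszul X Y Z x + koszul X Y W x"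
  by (simp add: koszul_apply calculus_simps)

text \<open>
  Each of the two Lie derivatives is tensorial in \<open>Z\<close>: \<open>\<rho>(X)(f g(Y,Z))\<close> and \<open>g(Y,[X,f Z])\<close> contain
  the same term \<open>\<rho>(X)(f) g(Y,Z)\<close>, and likewise with \<open>X\<close> and \<open>Y\<close> exchanged.
\<close>

lemma koszul_smult_form:
  "X \<in> \<Gamma> \<Longrightarrow> Y \<in> \<Gamma> \<Longrightarrow> Z \<in> \<Gamma> \<Longrightarrow> f \<in> C_infinity M \<Longrightarrow> koszul X Y (f \<odot> Z) x = f x * koszul X Y Z x"
  by (simp add: koszul_apply calculus_simps metric_eval_commute[of Y X] algebra_simps)

lemma koszul_commute: "X \<in> \<Gamma> \<Longrightarrow> Y \<in> \<Gamma> \<Longrightarrow> koszul X Y = koszul Y X"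
  by (simp add: fun_eq_iff koszul_apply metric_eval_commute[of X Y])

lemma koszul_add_left:
  "X \<in> \<Gamma> \<Longrightarrow> X' \<in> \<Gamma> \<Longrightarrow> Y \<in> \<Gamma> \<Longrightarrow> Z \<in> \<Gamma> \<Longrightarrow> koszul (X + X') Y Z x = koszul X Y Z x + koszul X' Y Z x"
  by (simp add: koszul_apply calculus_simps)

text \<open>
  The terms \<open>\<rho>(Z)(f) g(X,Y)\<close> from \<open>g(Y,[f X,Z])\<close> and from \<open>d(g(f X,Y))\<close> cancel, and only the derivative
  of \<open>f\<close> along \<open>Y\<close> survives.
\<close>

lemma koszul_smult_left:
  "X \<in> \<Gamma> \<Longrightarrow> Y \<in> \<Gamma> \<Longrightarrow> Z \<in> \<Gamma> \<Longrightarrow> f \<in> C_infinity M \<Longrightarrow>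
    koszul (f \<odot> X) Y Z x = f x * koszul X Y Z x + anchor_deriv A Y f x * metric_eval g X Z x"
  by (simp add: koszul_apply calculus_simps metric_eval_commute[of Y X] algebra_simps)

section \<open>The symmetric product\<close>

lemma sym_product_eq: "sym_product M A g X Y = sharp M A g (koszul X Y)"
  by (simp add: sym_product_def koszul_def)

lemma sym_product_section:
  assumes "X \<in> \<Gamma>" "Y \<in> \<Gamma>"
  shows "sym_product M A g X Y \<in> \<Gamma>"
    and "Z \<in> \<Gamma> \<Longrightarrow> metric_eval g (sym_product M A g X Y) Z = koszul X Y Z"
  unfolding sym_product_eq
  using sharp_form[of "koszul X Y"] koszul_smooth koszul_add_form koszul_smult_form assms by simp_all

lemma sym_product_commute: "X \<in> \<Gamma> \<Longrightarrow> Y \<in> \<Gamma> \<Longrightarrow> sym_product M A g X Y = sym_product M A g Y X"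
  by (simp add: sym_product_eq koszul_commute[of X Y])

lemma sym_product_add_left:
  "X \<in> \<Gamma> \<Longrightarrow> X' \<in> \<Gamma> \<Longrightarrow> Y \<in> \<Gamma> \<Longrightarrow> sym_product M A g (X + X') Y = sym_product M A g X Y + sym_product M A g X' Y"
  by (rule section_eqI) (simp_all add: calculus_simps sym_product_section koszul_add_left)

lemma sym_product_smult_left:
  "X \<in> \<Gamma> \<Longrightarrow> Y \<in> \<Gamma> \<Longrightarrow> f \<in> C_infinity M \<Longrightarrow>
    sym_product M A g (f \<odot> X) Y = f \<odot> sym_product M A g X Y + anchor_deriv A Y f \<odot> X"
  by (rule section_eqI) (simp_all add: calculus_simps sym_product_section koszul_smult_left)

section \<open>The Levi-Civita connection\<close>

text \<open>
  Both defining equations of \<open>D\<close> are used as rewrite rules that eliminate the anchor and the bracket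
  from the Koszul form.
\<close>

lemma levi_civita_imp_formula:
  assumes D: "levi_civita M A g D" and X: "X \<in> \<Gamma>" and Y: "Y \<in> \<Gamma>"
  shows "D X Y = (1/2) *\<^sub>R (bracket A X Y + sym_product M A g X Y)"
proof -
  have sec: "D V W \<in> \<Gamma>" if "V \<in> \<Gamma>" "W \<in> \<Gamma>" for V W
    using D that unfolding levi_civita_def connection_def by blast
  have br: "bracket A V W = D V W - D W V" if "V \<in> \<Gamma>" "W \<in> \<Gamma>" for V W
    using D that unfolding levi_civita_def torsion_def by (simp add: fun_eq_iff)
  have met: "anchor_deriv A U (metric_eval g V W) x = metric_eval g (D U V) W x + metric_eval g V (D U W) x"
    if "U \<in> \<Gamma>" "V \<in> \<Gamma>" "W \<in> \<Gamma>" for U V W x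
  proof -
    have "metric_deriv A D g U V W = 0" using D that unfolding levi_civita_def by blast
    then have "metric_deriv A D g U V W x = 0" by simp
    then show ?thesis by (simp add: metric_deriv_def)
  qed
  have "sym_product M A g X Y = D X Y + D Y X"
  proof (rule section_eqI)
    fix Z x assume Z: "Z \<in> \<Gamma>"
    show "metric_eval g (sym_product M A g X Y) Z x = metric_eval g (D X Y + D Y X) Z x"
      using X Y Z
      by (simp add: sym_product_section koszul_apply met br sec calculus_simps metric_eval_commute[of "D Z X" Y])
  qed (use X Y in \<open>simp_all add: sym_product_section sec section_add\<close>)
  then have "bracket A X Y + sym_product M A g X Y = 2 *\<^sub>R D X Y"
    using br[OF X Y] by (simp add: scaleR_2)
  then show ?thesis by simp
qed

text \<open>
  The terms \<open>\<plusminus> \<rho>(Y)(f) X\<close> of the bracket and of the symmetric product cancel in the first argument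
  and the terms \<open>\<rho>(X)(f) Y\<close> add up in the second one. The other properties separate into the symmetric
  and the skew part of the formula.
\<close>

lemma formula_imp_levi_civita:
  assumes D: "\<And>X Y. X \<in> \<Gamma> \<Longrightarrow> Y \<in> \<Gamma> \<Longrightarrow> D X Y = (1/2) *\<^sub>R (bracket A X Y + sym_product M A g X Y)"
  shows "levi_civita M A g D"
proof -
  have sec: "D X Y \<in> \<Gamma>" if "X \<in> \<Gamma>" "Y \<in> \<Gamma>" for X Y
    using that by (simp add: D sym_product_section section_simps)
  have add_left: "D (X + X') Y = D X Y + D X' Y" if "X \<in> \<Gamma>" "X' \<in> \<Gamma>" "Y \<in> \<Gamma>" for X X' Y
    using that by (simp add: D calculus_simps sym_product_add_left algebra_simps)
  have add_right: "D X (Y + Y') = D X Y + D X Y'" if "X \<in> \<Gamma>" "Y \<in> \<Gamma>" "Y' \<in> \<Gamma>" for X Y Y'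
    using that by (simp add: D calculus_simps sym_product_commute[of X] sym_product_add_left algebra_simps)
  have smult_left: "D (f \<odot> X) Y = f \<odot> D X Y" if "X \<in> \<Gamma>" "Y \<in> \<Gamma>" "f \<in> C_infinity M" for X Y f
    using that by (simp add: D calculus_simps sym_product_smult_left)
      (simp add: fun_mult_def fun_eq_iff algebra_simps)
  have smult_right: "D X (f \<odot> Y) = f \<odot> D X Y + anchor_deriv A X f \<odot> Y"
    if "X \<in> \<Gamma>" "Y \<in> \<Gamma>" "f \<in> C_infinity M" for X Y f
    using that
    by (simp add: D calculus_simps sym_product_commute[of X] sym_product_smult_left)
      (simp add: fun_mult_def fun_eq_iff algebra_simps flip: scaleR_left.add)
  have scale_left: "D (c *\<^sub>R X) Y = c *\<^sub>R D X Y" if "X \<in> \<Gamma>" "Y \<in> \<Gamma>" for X Y c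
    using smult_left[OF that C_infinity_const] by (simp add: scaleR_eq_smult)
  have scale_right: "D X (c *\<^sub>R Y) = c *\<^sub>R D X Y" if "X \<in> \<Gamma>" "Y \<in> \<Gamma>" for X Y c
    using smult_right[OF that C_infinity_const, of c] that
    by (simp add: scaleR_eq_smult anchor_deriv_const) (simp add: fun_mult_def fun_eq_iff)
  have "connection M A D"
    unfolding connection_def bilinear_on_set_def linear_on_set_def
    by (intro conjI ballI allI)
      (simp_all only: sec add_left add_right smult_left smult_right scale_left scale_right)
  moreover have "torsion A D X Y = 0" if "X \<in> \<Gamma>" "Y \<in> \<Gamma>" for X Y
  proof -
    have "torsion A D X Y = (1/2) *\<^sub>R (bracket A X Y - bracket A Y X) - bracket A X Y"
      using that by (simp add: torsion_def D sym_product_commute[of X Y] algebra_simps)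
    then show ?thesis using bracket_skew[OF that(2,1)] by (simp add: fun_eq_iff)
  qed
  moreover have "metric_deriv A D g X Y Z = 0" if XYZ: "X \<in> \<Gamma>" "Y \<in> \<Gamma>" "Z \<in> \<Gamma>" for X Y Z
  proof
    fix x
    have half: "metric_eval g (D X V) W x = (metric_eval g (bracket A X V) W x + koszul X V W x) / 2"
      if "V \<in> \<Gamma>" "W \<in> \<Gamma>" for V W
      using that XYZ by (simp add: D scaleR_eq_smult calculus_simps sym_product_section)
    have "metric_eval g X (bracket A Z Y) x = - metric_eval g X (bracket A Y Z) x"
    proof -
      have "bracket A Z Y = (\<lambda>_. -1) \<odot> bracket A Y Z"
        using bracket_skew[OF XYZ(3,2)] by (simp add: fun_mult_def fun_eq_iff)
      then show ?thesis using XYZ by (simp add: metric_eval_smult_right)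
    qed
    then show "metric_deriv A D g X Y Z x = 0 x"
      using XYZ half[of Y Z] half[of Z Y]
      by (simp add: metric_deriv_def koszul_apply metric_eval_commute[of Y "D X Z"] sec
          metric_eval_commute[of Z "bracket A X Y"] metric_eval_commute[of Y "bracket A X Z"]
          metric_eval_commute[of Z Y] metric_eval_commute[of Z X] algebra_simps)
  qed
  ultimately show ?thesis unfolding levi_civita_def by blast
qed

end

theorem corollary5p6:
  fixes M :: "('m::{t2_space, second_countable_topology}, 'e::{real_inner, heine_borel}) atlas"
    and A :: "('m, 'v::real_vector, 'f::{real_inner, heine_borel}) algebroid"
    and g :: "'m \<Rightarrow> 'v \<Rightarrow> 'v \<Rightarrow> real"
    and D :: "('m \<Rightarrow> 'v) \<Rightarrow> ('m \<Rightarrow> 'v) \<Rightarrow> 'm \<Rightarrow> 'v"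
  assumes "smooth_manifold M"
    and "skew_algebroid M A"
    and "pseudo_riemannian_metric M A g"
  shows "levi_civita M A g D \<longleftrightarrow>
    (\<forall>X\<in>sections M A. \<forall>Y\<in>sections M A.
      D X Y = (1/2) *\<^sub>R (bracket A X Y + sym_product M A g X Y))"
proof -
  interpret metric_algebroid M A g
    using assms by unfold_locales
  show ?thesis
    using levi_civita_imp_formula formula_imp_levi_civita by blast
qed

end
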